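(* Let $H$ and $K$ be separable Hilbert spaces, and let $V=\{(V_i,v_i)\}_{i\in I}$ and $W=\{(W_j,w_j)\}_{j\in J}$ be fusion frames for $H$ and $K$ with bounds $(A,B)$ and $(C,D)$, respectively. Let $S_{V\otimes W}$ be the fusion frame operator of $V\otimes W=\{(V_i\otimes W_j,v_iw_j)\}_{(i,j)\in I\times J}$, and for $i\in I$, $j\in J$ let $T_i\otimes U_j=P_{V_i\otimes W_j}S_{V\otimes W}^{-1}$. Then $\{v_i^2w_j^2\,(T_i\otimes U_j)\}_{(i,j)\in I\times J}$ is a resolution of the identity operator on $H\otimes K$. Furthermore, $$\frac{AC}{B^2D^2}\,a^2b^2\,\|f\otimes g\|^2\le\sum_{i,j}v_i^2w_j^2\,\|(T_i\otimes U_j)(f\otimes g)\|^2\le\frac{BD}{A^2C^2}\,a^2b^2\,\|f\otimes g\|^2$$ for all $f\otimes g\in H\otimes K$, where $a$ and $b$ are constants with $ab=1$.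
   Context: $H\otimes K$ is the Hilbert space tensor product, with $\langle f\otimes g,f'\otimes g'\rangle=\langle f,f'\rangle\langle g,g'\rangle$ and $\|f\otimes g\|=\|f\|\|g\|$; $V_i\otimes W_j$ is the closed subspace of $H\otimes K$ given by the tensor product of the closed subspaces $V_i\subset H$ and $W_j\subset K$. $P_X$ denotes the orthogonal projection onto a closed subspace $X$. For bounded operators $Q$ on $H$ and $T$ on $K$, $Q\otimes T$ is the bounded operator on $H\otimes K$ with $(Q\otimes T)(f\otimes g)=Qf\otimes Tg$. "For all $f\otimes g\in H\otimes K$" means for all $f\in H$ and $g\in K$. A family $V=\{(V_i,v_i)\}_{i\in I}$ of closed subspaces of $H$ with weights $v_i>0$ is a fusion frame for $H$ with bounds $(A,B)$, $0<A\le B<\infty$, if $A\|f\|^2\le\sum_{i\in I}v_i^2\|P_{V_i}f\|^2\le B\|f\|^2$ for all $f\in H$ (similarly for $K$). When $V$ and $W$ are fusion frames, the fusion frame operator of $V\otimes W$ is the bounded invertible linear operator $S_{V\otimes W}$ on $H\otimes K$ with $S_{V\otimes W}(f\otimes g)=\sum_{i,j}v_i^2w_j^2P_{V_i\otimes W_j}(f\otimes g)$. A family of bounded operators $\{R_{ij}\}_{i,j}$ on $H\otimes K$ is a resolution of the identity operator on $H\otimes K$ if for all $f\otimes g\in H\otimes K$, $f\otimes g=\sum_{i,j}R_{ij}(f\otimes g)$, with the series converging unconditionally. *)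

theory Defs
  imports "HOL-Analysis.Analysis"
begin

text \<open>
  Scalar fields. The axioms admit \<open>\<real>\<close> and \<open>\<complex>\<close> and, up to isomorphism, nothing else: a scalar fixed
  by the involution satisfies \<open>x\<^sup>2 = of_real ((norm x)\<^sup>2)\<close>, so it is real, and hence every scalar
  is a root of a real quadratic polynomial.
\<close>

class rc_field = real_normed_field +
  fixes conjg :: "'a \<Rightarrow> 'a"
  assumes conjg_add: "conjg (x + y) = conjg x + conjg y"
    and conjg_mult: "conjg (x * y) = conjg x * conjg y"
    and conjg_conjg: "conjg (conjg x) = x"
    and mult_conjg: "x * conjg x = (norm x)\<^sup>2 *\<^sub>R 1"

instantiation real :: rc_field
begin
definition conjg_real :: "real \<Rightarrow> real" where "conjg_real x = x"
instance by standard (auto simp: conjg_real_def power2_eq_square)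
end

instantiation complex :: rc_field
begin
definition conjg_complex :: "complex \<Rightarrow> complex" where "conjg_complex = cnj"
instance
proof
  show "x * conjg x = (norm x)\<^sup>2 *\<^sub>R 1" for x :: complex
    by (simp only: conjg_complex_def scaleR_conv_of_real mult_1_right complex_norm_square)
qed (simp_all add: conjg_complex_def)
end

text \<open>
  Completeness is part of the sort \<open>banach\<close>; the inner product is linear in the first argument.
\<close>

locale hilbert_space = vector_space scale
  for scale :: "'k::rc_field \<Rightarrow> 'h::banach \<Rightarrow> 'h" +
  fixes ip :: "'h \<Rightarrow> 'h \<Rightarrow> 'k"
  assumes scale_of_real: "scale (of_real r) x = r *\<^sub>R x"
    and ip_add_left: "ip (x + y) z = ip x z + ip y z"
    and ip_scale_left: "ip (scale c x) y = c * ip x y"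
    and ip_commute: "ip y x = conjg (ip x y)"
    and ip_self: "ip x x = of_real ((norm x)\<^sup>2)"

lemma hilbert_space_real_inner:
  "hilbert_space scaleR (inner :: 'a::{real_inner,banach} \<Rightarrow> 'a \<Rightarrow> real)"
proof
  show "x \<bullet> x = of_real ((norm x)\<^sup>2)" for x :: 'a
    by (simp add: power2_norm_eq_inner)
qed (simp_all add: scaleR_add_right scaleR_add_left inner_add_left inner_add_right conjg_real_def
    inner_commute)

lemma hilbert_space_complex: "hilbert_space (*) (\<lambda>x y::complex. x * cnj y)"
proof
  show "x * cnj x = of_real ((norm x)\<^sup>2)" for x :: complex
    by (rule complex_norm_square [symmetric])
qed (simp_all add: distrib_left distrib_right conjg_complex_def scaleR_conv_of_real)

definition closed_subspace :: "('k::rc_field \<Rightarrow> 'h::banach \<Rightarrow> 'h) \<Rightarrow> 'h set \<Rightarrow> bool" where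
  "closed_subspace s X \<longleftrightarrow> module.subspace s X \<and> closed X"

definition orth_proj :: "('h \<Rightarrow> 'h \<Rightarrow> 'k::rc_field) \<Rightarrow> 'h::banach set \<Rightarrow> 'h \<Rightarrow> 'h" where
  "orth_proj ip X f = (THE p. p \<in> X \<and> (\<forall>x\<in>X. ip (f - p) x = 0))"

definition bounded_op ::
    "('k::rc_field \<Rightarrow> 'h::banach \<Rightarrow> 'h) \<Rightarrow> ('h \<Rightarrow> 'h) \<Rightarrow> bool" where
  "bounded_op s F \<longleftrightarrow> Vector_Spaces.linear s s F \<and> (\<exists>M. \<forall>x. norm (F x) \<le> M * norm x)"

definition fusion_frame ::
    "('k::rc_field \<Rightarrow> 'h::banach \<Rightarrow> 'h) \<Rightarrow> ('h \<Rightarrow> 'h \<Rightarrow> 'k) \<Rightarrow>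
      'i set \<Rightarrow> ('i \<Rightarrow> 'h set) \<Rightarrow> ('i \<Rightarrow> real) \<Rightarrow> real \<Rightarrow> real \<Rightarrow> bool" where
  "fusion_frame s ip I V v A B \<longleftrightarrow>
     (\<forall>i\<in>I. closed_subspace s (V i) \<and> 0 < v i) \<and> 0 < A \<and> A \<le> B \<and>
     (\<forall>f. (\<lambda>i. (v i)\<^sup>2 * (norm (orth_proj ip (V i) f))\<^sup>2) summable_on I \<and>
          A * (norm f)\<^sup>2 \<le> (\<Sum>\<^sub>\<infinity>i\<in>I. (v i)\<^sup>2 * (norm (orth_proj ip (V i) f))\<^sup>2) \<and>
          (\<Sum>\<^sub>\<infinity>i\<in>I. (v i)\<^sup>2 * (norm (orth_proj ip (V i) f))\<^sup>2) \<le> B * (norm f)\<^sup>2)"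

text \<open>
  The Hilbert space tensor product is specified, up to unitary equivalence, as a Hilbert space
  \<open>L\<close> together with a bilinear map \<open>t\<close>, where \<open>t f g\<close> plays the role of \<open>f \<otimes> g\<close>, such that inner
  products multiply and the linear span of the elementary tensors is dense.
\<close>

locale hilbert_tensor =
  H: hilbert_space sH ipH + K: hilbert_space sK ipK + L: hilbert_space sL ipL
  for sH :: "'k::rc_field \<Rightarrow> 'h::banach \<Rightarrow> 'h" and ipH :: "'h \<Rightarrow> 'h \<Rightarrow> 'k"
    and sK :: "'k \<Rightarrow> 'g::banach \<Rightarrow> 'g" and ipK :: "'g \<Rightarrow> 'g \<Rightarrow> 'k"
    and sL :: "'k \<Rightarrow> 'l::banach \<Rightarrow> 'l" and ipL :: "'l \<Rightarrow> 'l \<Rightarrow> 'k" +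
  fixes t :: "'h \<Rightarrow> 'g \<Rightarrow> 'l"
  assumes tensor_add_left: "t (f + f') g = t f g + t f' g"
    and tensor_add_right: "t f (g + g') = t f g + t f g'"
    and tensor_scale_left: "t (sH c f) g = sL c (t f g)"
    and tensor_scale_right: "t f (sK c g) = sL c (t f g)"
    and ip_tensor: "ipL (t f g) (t f' g') = ipH f f' * ipK g g'"
    and dense_tensors: "closure (L.span {t f g |f g. True}) = UNIV"

definition tensor_subspace ::
    "('k::rc_field \<Rightarrow> 'l::banach \<Rightarrow> 'l) \<Rightarrow> ('h \<Rightarrow> 'g \<Rightarrow> 'l) \<Rightarrow>
      'h set \<Rightarrow> 'g set \<Rightarrow> 'l set" where
  "tensor_subspace s t X Y = closure (module.span s {t f g |f g. f \<in> X \<and> g \<in> Y})"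

definition tensor_op ::
    "('k::rc_field \<Rightarrow> 'l::banach \<Rightarrow> 'l) \<Rightarrow> ('h \<Rightarrow> 'g \<Rightarrow> 'l) \<Rightarrow>
      ('h \<Rightarrow> 'h) \<Rightarrow> ('g \<Rightarrow> 'g) \<Rightarrow> 'l \<Rightarrow> 'l" where
  "tensor_op s t Q T = (THE R. bounded_op s R \<and> (\<forall>f g. R (t f g) = t (Q f) (T g)))"

definition tensor_frame_operator ::
    "('k::rc_field \<Rightarrow> 'l::banach \<Rightarrow> 'l) \<Rightarrow> ('l \<Rightarrow> 'l \<Rightarrow> 'k) \<Rightarrow> ('h \<Rightarrow> 'g \<Rightarrow> 'l) \<Rightarrow>
      'i set \<Rightarrow> ('i \<Rightarrow> 'h set) \<Rightarrow> ('i \<Rightarrow> real) \<Rightarrow>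
      'j set \<Rightarrow> ('j \<Rightarrow> 'g set) \<Rightarrow> ('j \<Rightarrow> real) \<Rightarrow> 'l \<Rightarrow> 'l" where
  "tensor_frame_operator s ip t I V v J W w =
     (THE S. bounded_op s S \<and> bij S \<and> bounded_op s (inv S) \<and>
        (\<forall>f g. ((\<lambda>(i, j). ((v i)\<^sup>2 * (w j)\<^sup>2) *\<^sub>R
                    orth_proj ip (tensor_subspace s t (V i) (W j)) (t f g))
                 has_sum S (t f g)) (I \<times> J)))"

text \<open>
  Unconditional convergence is \<open>has_sum\<close>: convergence of the net of finite partial sums.
\<close>

definition tensor_resolution_of_identity ::
    "('k::rc_field \<Rightarrow> 'l::banach \<Rightarrow> 'l) \<Rightarrow> ('h \<Rightarrow> 'g \<Rightarrow> 'l) \<Rightarrow>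
      'n set \<Rightarrow> ('n \<Rightarrow> 'l \<Rightarrow> 'l) \<Rightarrow> bool" where
  "tensor_resolution_of_identity s t N R \<longleftrightarrow>
     (\<forall>n\<in>N. bounded_op s (R n)) \<and>
     (\<forall>f g. ((\<lambda>n. R n (t f g)) has_sum t f g) N)"

end

theory Submission
  imports Defs
begin

text \<open>
  A finite sum of elementary tensors can be rewritten as \<open>\<Sum>m. h m \<otimes> e m\<close> with orthogonal \<open>e m\<close>, so its
  squared norm is \<open>\<Sum>m. \<parallel>e m\<parallel>\<^sup>2 \<parallel>h m\<parallel>\<^sup>2\<close>, and the frame inequalities of \<open>V\<close>, applied to each \<open>h m\<close>, show
  by density that the subspaces \<open>V i \<otimes> K\<close> form a fusion frame of \<open>H \<otimes> K\<close> with the bounds of \<open>V\<close>;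
  likewise for \<open>H \<otimes> W j\<close>. The projection onto \<open>V i \<otimes> W j\<close> is the composition of those onto \<open>V i \<otimes> K\<close>
  and \<open>H \<otimes> W j\<close>, so \<open>V \<otimes> W\<close> is a fusion frame with bounds \<open>A C\<close> and \<open>B D\<close>.

  The Bessel bound makes the series defining a fusion frame operator converge unconditionally, and
  the lower frame bound makes that operator coercive, hence invertible by a contraction argument.
  Applying the frame series and the frame inequalities to \<open>S\<^sup>-\<^sup>1 (f \<otimes> g)\<close>, whose norm lies between
  \<open>\<parallel>f \<otimes> g\<parallel> / (B D)\<close> and \<open>\<parallel>f \<otimes> g\<parallel> / (A C)\<close>, gives both claims. Finally
  \<open>S = S\<^sub>V \<otimes> S\<^sub>W\<close> on elementary tensors, which yields \<open>T i = P (V i) S\<^sub>V\<^sup>-\<^sup>1\<close> and \<open>U j = P (W j) S\<^sub>W\<^sup>-\<^sup>1\<close>.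
\<close>

section \<open>Hilbert spaces and orthogonal projections\<close>

lemma conjg_of_real [simp]: "conjg (of_real r :: 'k::rc_field) = of_real r"
proof (cases "r = 0")
  case True
  have "conjg (0::'k) = conjg 0 + conjg 0"
    using conjg_add[of "0::'k" 0] by simp
  then show ?thesis
    using True by simp
next
  case False
  have "of_real r * conjg (of_real r :: 'k) = of_real r * of_real r"
    by (simp add: mult_conjg scaleR_conv_of_real power2_eq_square)
  then show ?thesis
    using False by (metis mult_left_cancel of_real_eq_0_iff)
qed

lemma conjg_0 [simp]: "conjg (0 :: 'k::rc_field) = 0"
  using conjg_of_real[of 0] by (simp del: conjg_of_real)

text \<open>
  By polarization, \<open>re_ip\<close> is the real part of the inner product of any Hilbert space structure
  compatible with the norm.
\<close>

definition re_ip :: "'a::real_normed_vector \<Rightarrow> 'a \<Rightarrow> real" where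
  "re_ip x y = ((norm (x + y))\<^sup>2 - (norm x)\<^sup>2 - (norm y)\<^sup>2) / 2"

lemma re_ip_self: "re_ip x x = (norm x)\<^sup>2"
proof -
  have "norm (x + x) = 2 * norm x"
    by (metis norm_scaleR scaleR_2 abs_numeral)
  then show ?thesis
    by (simp add: re_ip_def power_mult_distrib)
qed

lemma summable_on_if_norm_sum_le:
  fixes f :: "'n \<Rightarrow> 'a::banach" and q :: "'n \<Rightarrow> real"
  assumes q: "q summable_on N" and q0: "\<And>n. n \<in> N \<Longrightarrow> 0 \<le> q n" and B: "0 \<le> B"
    and le: "\<And>F. finite F \<Longrightarrow> F \<subseteq> N \<Longrightarrow> (norm (sum f F))\<^sup>2 \<le> B * sum q F"
  shows "f summable_on N"
proof -
  have "\<exists>P. eventually P (finite_subsets_at_top N) \<and>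
              (\<forall>F F'. P F \<and> P F' \<longrightarrow> dist (sum f F) (sum f F') < e)" if e: "e > 0" for e
  proof -
    define d where "d = (e/3)\<^sup>2 / (B + 1)"
    have d: "d > 0"
      using e B by (simp add: d_def)
    obtain F0 where F0: "finite F0" "F0 \<subseteq> N" "dist (sum q F0) (infsum q N) \<le> d"
      using infsum_finite_approximation[OF q d] by blast
    have tail: "norm (sum f F - sum f F0) \<le> e/3" if F: "finite F" "F0 \<subseteq> F" "F \<subseteq> N" for F
    proof -
      have "sum q F \<le> infsum q N"
        using finite_sum_le_infsum[OF q F(1,3)] q0 by auto
      then have "sum q (F - F0) \<le> d"
        using F0 F by (auto simp: sum_diff dist_real_def)
      moreover have "sum q (F - F0) \<ge> 0"
        using F q0 by (intro sum_nonneg) auto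
      ultimately have "B * sum q (F - F0) \<le> (B + 1) * d"
        using B by (intro mult_mono) auto
      moreover have "(norm (sum f (F - F0)))\<^sup>2 \<le> B * sum q (F - F0)"
        using F by (intro le) auto
      moreover have "(B + 1) * d = (e/3)\<^sup>2"
        using B by (simp add: d_def)
      ultimately have "(norm (sum f (F - F0)))\<^sup>2 \<le> (e/3)\<^sup>2"
        by linarith
      then have "norm (sum f (F - F0)) \<le> e/3"
        by (rule power2_le_imp_le) (use e in simp)
      then show ?thesis
        using F by (simp add: sum_diff)
    qed
    have "eventually (\<lambda>F. finite F \<and> F0 \<subseteq> F \<and> F \<subseteq> N) (finite_subsets_at_top N)"
      using F0 by (auto simp: eventually_finite_subsets_at_top)
    moreover have "dist (sum f F) (sum f F') < e"
      if "finite F \<and> F0 \<subseteq> F \<and> F \<subseteq> N" "finite F' \<and> F0 \<subseteq> F' \<and> F' \<subseteq> N" for F F'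
    proof -
      have "dist (sum f F) (sum f F') \<le> dist (sum f F) (sum f F0) + dist (sum f F') (sum f F0)"
        by (rule dist_triangle2)
      also have "\<dots> \<le> e/3 + e/3"
        unfolding dist_norm using that by (intro add_mono tail) auto
      also have "\<dots> < e"
        using e by simp
      finally show ?thesis .
    qed
    ultimately show ?thesis
      by (intro exI[of _ "\<lambda>F. finite F \<and> F0 \<subseteq> F \<and> F \<subseteq> N"]) simp
  qed
  then have "cauchy_filter (filtermap (sum f) (finite_subsets_at_top N))"
    by (simp add: cauchy_filter_metric_filtermap)
  moreover have "complete (UNIV::'a set)"
    by (rule complete_UNIV)
  ultimately obtain L' where "(sum f \<longlongrightarrow> L') (finite_subsets_at_top N)"
    using complete_uniform[where S=UNIV] by (force simp add: filterlim_def)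
  then show ?thesis
    using summable_on_def has_sum_def by blast
qed

context hilbert_space
begin

lemma ip_add_right: "ip x (y + z) = ip x y + ip x z"
  by (metis conjg_add ip_add_left ip_commute)

lemma ip_scale_right: "ip x (scale c y) = conjg c * ip x y"
  by (metis conjg_mult ip_commute ip_scale_left)

lemma norm_scale: "norm (scale c x) = norm c * norm x"
proof -
  have "(of_real ((norm (scale c x))\<^sup>2) :: 'k) = c * conjg c * of_real ((norm x)\<^sup>2)"
    by (simp only: ip_self[symmetric] ip_scale_left ip_scale_right mult_ac)
  also have "\<dots> = of_real ((norm c * norm x)\<^sup>2)"
    by (simp add: mult_conjg power_mult_distrib scaleR_conv_of_real)
  finally have "(norm (scale c x))\<^sup>2 = (norm c * norm x)\<^sup>2"
    by (simp only: of_real_eq_iff)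
  then show ?thesis
    by simp
qed

lemma of_real_re_ip: "of_real (2 * re_ip x y) = ip x y + ip y x"
proof -
  have "of_real ((norm (x + y))\<^sup>2) = of_real ((norm x)\<^sup>2) + ip x y + ip y x + of_real ((norm y)\<^sup>2)"
    by (simp only: ip_self[symmetric] ip_add_left ip_add_right ac_simps)
  moreover have "2 * re_ip x y = (norm (x + y))\<^sup>2 - (norm x)\<^sup>2 - (norm y)\<^sup>2"
    by (simp add: re_ip_def)
  ultimately show ?thesis
    by (simp only: of_real_diff) simp
qed

lemma re_ip_commute: "re_ip (x::'h) y = re_ip y x"
  by (simp add: re_ip_def add.commute)

lemma re_ip_add_left: "re_ip (x + y :: 'h) z = re_ip x z + re_ip y z"
proof -
  have "(of_real (2 * re_ip (x + y) z) :: 'k) = of_real (2 * re_ip x z + 2 * re_ip y z)"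
    by (simp only: of_real_add of_real_re_ip ip_add_left ip_add_right ac_simps)
  then show ?thesis
    unfolding of_real_eq_iff by simp
qed

lemma re_ip_scaleR_left: "re_ip (r *\<^sub>R x :: 'h) y = r * re_ip x y"
proof -
  have "(of_real (2 * re_ip (r *\<^sub>R x) y) :: 'k) = of_real (r * (2 * re_ip x y))"
    by (simp only: scale_of_real[symmetric] of_real_mult[of r "2 * _"] of_real_re_ip ip_scale_left
        ip_scale_right conjg_of_real distrib_left)
  then show ?thesis
    unfolding of_real_eq_iff by simp
qed

lemma re_ip_add_right: "re_ip (z::'h) (x + y) = re_ip z x + re_ip z y"
  by (simp only: re_ip_commute[of z] re_ip_add_left)

lemma re_ip_scaleR_right: "re_ip (y::'h) (r *\<^sub>R x) = r * re_ip y x"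
  by (simp only: re_ip_commute[of y] re_ip_scaleR_left)

lemma norm_add_sq: "(norm (x + y :: 'h))\<^sup>2 = (norm x)\<^sup>2 + 2 * re_ip x y + (norm y)\<^sup>2"
  by (simp add: re_ip_def field_simps)

lemma norm_diff_sq: "(norm (x - y :: 'h))\<^sup>2 = (norm x)\<^sup>2 - 2 * re_ip x y + (norm y)\<^sup>2"
  using norm_add_sq[of x "(-1) *\<^sub>R y"] unfolding re_ip_scaleR_right by simp

lemma re_ip_young:
  assumes "0 < r"
  shows "2 * re_ip (x::'h) y \<le> r * (norm x)\<^sup>2 + (norm y)\<^sup>2 / r"
proof -
  have "0 \<le> (norm (r *\<^sub>R x - y))\<^sup>2"
    by simp
  also have "\<dots> = r\<^sup>2 * (norm x)\<^sup>2 - 2 * r * re_ip x y + (norm y)\<^sup>2"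
    by (simp add: norm_diff_sq re_ip_scaleR_left power_mult_distrib)
  finally show ?thesis
    using assms by (simp add: field_simps power2_eq_square)
qed

lemma re_ip_le: "re_ip (x::'h) y \<le> norm x * norm y"
proof -
  have "(norm (x + y))\<^sup>2 \<le> (norm x + norm y)\<^sup>2"
    by (intro power_mono norm_triangle_ineq) auto
  then show ?thesis
    by (simp add: norm_add_sq power2_sum)
qed

lemma re_ip_bound: "\<bar>re_ip (x::'h) y\<bar> \<le> norm x * norm y"
  using re_ip_le[of x y] re_ip_le[of "(-1) *\<^sub>R x" y]
  unfolding re_ip_scaleR_left by simp

sublocale re: bounded_bilinear "re_ip :: 'h \<Rightarrow> 'h \<Rightarrow> real"
proof
  show "\<exists>K. \<forall>x y. norm (re_ip (x::'h) y) \<le> norm x * norm y * K"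
    by (rule exI[of _ 1]) (simp add: re_ip_bound)
qed (auto simp: re_ip_add_left re_ip_add_right re_ip_scaleR_left re_ip_scaleR_right)

lemma re_ip_scale_ip: "re_ip x (scale (ip x y) y) = (norm (ip x y))\<^sup>2"
proof -
  have "(of_real (2 * re_ip x (scale (ip x y) y)) :: 'k) = of_real (2 * (norm (ip x y))\<^sup>2)"
    unfolding of_real_re_ip ip_scale_right ip_scale_left
    by (simp add: ip_commute[of y x] mult.commute[of "conjg _"] mult_conjg scaleR_conv_of_real)
  then have "2 * re_ip x (scale (ip x y) y) = 2 * (norm (ip x y))\<^sup>2"
    by (simp only: of_real_eq_iff)
  then show ?thesis
    by simp
qed

lemma norm_ip_le: "norm (ip x y) \<le> norm x * norm y"
proof (cases "ip x y = 0")
  case False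
  have "norm (ip x y) * norm (ip x y) \<le> norm (ip x y) * (norm x * norm y)"
    using re_ip_le[of x "scale (ip x y) y"]
    by (simp add: re_ip_scale_ip norm_scale power2_eq_square mult_ac)
  then show ?thesis
    using False by simp
qed auto

sublocale ip: bounded_bilinear ip
proof
  show "ip (r *\<^sub>R x) y = r *\<^sub>R ip x y" for r x y
    by (simp only: scale_of_real[symmetric] ip_scale_left scaleR_conv_of_real)
  show "ip x (r *\<^sub>R y) = r *\<^sub>R ip x y" for r x y
    by (simp only: scale_of_real[symmetric] ip_scale_right scaleR_conv_of_real conjg_of_real)
  show "\<exists>K. \<forall>x y. norm (ip x y) \<le> norm x * norm y * K"
    by (rule exI[of _ 1]) (simp add: norm_ip_le)
qed (auto simp: ip_add_left ip_add_right)

lemma re_ip_eq_0_if_ip_eq_0: "ip x y = 0 \<Longrightarrow> re_ip x y = 0"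
proof -
  assume "ip x y = 0"
  then have "(of_real (2 * re_ip x y) :: 'k) = of_real 0"
    unfolding of_real_re_ip by (simp add: ip_commute[of y x])
  then show ?thesis
    unfolding of_real_eq_iff by simp
qed

lemma bounded_linear_scale: "bounded_linear (scale c)"
proof
  show "scale c (x + y) = scale c x + scale c y" for x y
    by (rule scale_right_distrib)
  show "scale c (r *\<^sub>R x) = r *\<^sub>R scale c x" for r x
    by (simp only: scale_of_real[symmetric] scale_left_commute)
  show "\<exists>K. \<forall>x. norm (scale c x) \<le> norm x * K"
    by (rule exI[of _ "norm c"]) (simp add: norm_scale)
qed

lemma subspace_scaleR: "subspace X \<Longrightarrow> x \<in> X \<Longrightarrow> r *\<^sub>R x \<in> X"
  by (metis scale_of_real subspace_scale)

lemma closed_subspace_closure: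
  assumes X: "subspace X"
  shows "closed_subspace scale (closure X)"
  unfolding closed_subspace_def
proof (intro conjI subspaceI closed_closure)
  show "0 \<in> closure X"
    using X closure_subset subspace_0 by blast
  show "x + y \<in> closure X" if x: "x \<in> closure X" and y: "y \<in> closure X" for x y
  proof -
    obtain p q where "\<forall>n. p n \<in> X" "p \<longlonglongrightarrow> x" "\<forall>n. q n \<in> X" "q \<longlonglongrightarrow> y"
      using x y unfolding closure_sequential by blast
    then show ?thesis
      unfolding closure_sequential
      by (intro exI[of _ "\<lambda>n. p n + q n"]) (auto intro: tendsto_add subspace_add[OF X])
  qed
  show "scale c x \<in> closure X" if x: "x \<in> closure X" for c x
  proof -
    obtain p where "\<forall>n. p n \<in> X" "p \<longlonglongrightarrow> x"
      using x unfolding closure_sequential by blast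
    then show ?thesis
      unfolding closure_sequential
      by (intro exI[of _ "\<lambda>n. scale c (p n)"])
        (auto intro: bounded_linear.tendsto[OF bounded_linear_scale] subspace_scale[OF X])
  qed
qed

lemma ip_eq_0_closure_span:
  assumes "\<And>x. x \<in> G \<Longrightarrow> ip w x = 0" and z: "z \<in> closure (span G)"
  shows "ip w z = 0"
proof -
  have "subspace {x. ip w x = 0}"
    by (auto simp: subspace_def ip.zero_right ip_add_right ip_scale_right)
  then have "span G \<subseteq> {x. ip w x = 0}"
    using assms by (intro span_minimal) auto
  moreover have "closed {x. ip w x = 0}"
    by (intro closed_Collect_eq continuous_intros linear_continuous_on ip.bounded_linear_right)
  ultimately show ?thesis
    using z closure_minimal by blast
qed

lemma orth_proj_exists:
  assumes X: "closed_subspace scale X"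
  shows "\<exists>p\<in>X. \<forall>x\<in>X. ip (f - p) x = 0"
proof -
  have sub: "subspace X" and cl: "closed X"
    using X by (auto simp: closed_subspace_def)
  have ne: "X \<noteq> {}"
    using subspace_0[OF sub] by auto
  define d where "d = infdist f X"
  have d_le: "d \<le> norm (f - x)" if "x \<in> X" for x
    using infdist_le[OF that, of f] by (simp add: d_def dist_norm)
  have d0: "d \<ge> 0"
    by (simp add: d_def infdist_nonneg)
  have "\<exists>x\<in>X. norm (f - x) < d + 1 / Suc n" for n
  proof -
    have "Inf (dist f ` X) < d + 1 / Suc n"
      using ne by (simp add: d_def infdist_def)
    then show ?thesis
      using cInf_lessD[of "dist f ` X" "d + 1 / Suc n"] ne by (auto simp: dist_norm)
  qed
  then obtain p where pX: "\<And>n. p n \<in> X" and p: "\<And>n. norm (f - p n) < d + 1 / Suc n"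
    by metis
  have par: "(norm (x - y))\<^sup>2 \<le> 2 * ((norm (f - x))\<^sup>2 - d\<^sup>2) + 2 * ((norm (f - y))\<^sup>2 - d\<^sup>2)"
    if "x \<in> X" "y \<in> X" for x y
  proof -
    have mid: "(1/2) *\<^sub>R (x + y) \<in> X"
      using that by (intro subspace_scaleR[OF sub] subspace_add[OF sub])
    have "d\<^sup>2 \<le> (norm (f - (1/2) *\<^sub>R (x + y)))\<^sup>2"
      using d_le[OF mid] d0 by (intro power_mono) auto
    moreover have "(f - x) + (f - y) = 2 *\<^sub>R (f - (1/2) *\<^sub>R (x + y))"
      by (simp add: algebra_simps scaleR_2)
    then have "(norm ((f - x) + (f - y)))\<^sup>2 = 4 * (norm (f - (1/2) *\<^sub>R (x + y)))\<^sup>2"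
      by (simp add: power_mult_distrib)
    moreover have "(norm (x - y))\<^sup>2 = (norm ((f - x) - (f - y)))\<^sup>2"
      by (simp add: norm_minus_commute)
    ultimately show ?thesis
      using norm_add_sq[of "f - x" "f - y"] norm_diff_sq[of "f - x" "f - y"] by argo
  qed
  have near: "(norm (f - p n))\<^sup>2 - d\<^sup>2 \<le> (2 * d + 1) * (1 / Suc n)" for n
  proof -
    have "(norm (f - p n))\<^sup>2 \<le> (d + 1 / Suc n)\<^sup>2"
      using p[of n] by (intro power_mono) auto
    also have "\<dots> = d\<^sup>2 + 2 * d * (1 / Suc n) + (1 / Suc n) * (1 / Suc n)"
      by (simp add: power2_eq_square algebra_simps)
    also have "(1 / Suc n) * (1 / Suc n) \<le> (1::real) * (1 / Suc n)"
      by (intro mult_right_mono) auto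
    finally show ?thesis
      by (simp add: algebra_simps)
  qed
  have "Cauchy p"
  proof (rule metric_CauchyI)
    fix e :: real assume e: "0 < e"
    define c where "c = 4 * (2 * d + 1)"
    have c: "c > 0"
      using d0 by (simp add: c_def)
    obtain M where M: "c / e\<^sup>2 < real M"
      using reals_Archimedean2 by blast
    have "dist (p m) (p n) < e" if "M \<le> m" "M \<le> n" for m n
    proof -
      have small: "c * (1 / Suc k) < e\<^sup>2" if "M \<le> k" for k
      proof -
        have "c / e\<^sup>2 < real (Suc k)"
          using M that by simp
        then show ?thesis
          using e by (simp add: field_simps)
      qed
      have "(norm (p m - p n))\<^sup>2 \<le> c * (1 / Suc m) / 2 + c * (1 / Suc n) / 2"
        using par[OF pX pX, of m n] near[of m] near[of n] unfolding c_def by argo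
      also have "\<dots> < e\<^sup>2"
        using small[OF that(1)] small[OF that(2)] by argo
      finally show ?thesis
        using e by (simp add: dist_norm power_less_imp_less_base)
    qed
    then show "\<exists>M. \<forall>m\<ge>M. \<forall>n\<ge>M. dist (p m) (p n) < e"
      by blast
  qed
  then obtain q where q: "p \<longlonglongrightarrow> q"
    using Cauchy_convergent convergent_def by blast
  have qX: "q \<in> X"
    using closed_sequentially[OF cl _ q] pX by blast
  have "norm (f - q) \<le> d"
  proof (rule LIMSEQ_le)
    show "(\<lambda>n. norm (f - p n)) \<longlonglongrightarrow> norm (f - q)"
      by (intro tendsto_intros q)
    show "(\<lambda>n. d + 1 / Suc n) \<longlonglongrightarrow> d"
      using LIMSEQ_Suc[OF lim_1_over_n[where 'a=real]]
        tendsto_add[OF tendsto_const, of _ 0 sequentially d] by fastforce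
    show "\<exists>N. \<forall>n\<ge>N. norm (f - p n) \<le> d + 1 / real (Suc n)"
      using p less_imp_le by blast
  qed
  have perp: "re_ip (f - q) x = 0" if x: "x \<in> X" for x
  proof (rule ccontr)
    assume ne0: "re_ip (f - q) x \<noteq> 0"
    then have x0: "norm x \<noteq> 0"
      by (auto simp: re.zero_right)
    define s where "s = re_ip (f - q) x / (norm x)\<^sup>2"
    have "q + s *\<^sub>R x \<in> X"
      using qX x by (intro subspace_add[OF sub] subspace_scaleR[OF sub])
    then have "(norm (f - q))\<^sup>2 \<le> (norm (f - (q + s *\<^sub>R x)))\<^sup>2"
      using d_le \<open>norm (f - q) \<le> d\<close> by (intro power_mono) (auto intro: order_trans)
    also have "f - (q + s *\<^sub>R x) = (f - q) - s *\<^sub>R x"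
      by simp
    also have "(norm \<dots>)\<^sup>2 = (norm (f - q))\<^sup>2 - 2 * s * re_ip (f - q) x + s\<^sup>2 * (norm x)\<^sup>2"
      by (simp add: norm_diff_sq re_ip_scaleR_right power_mult_distrib)
    also have "s\<^sup>2 * (norm x)\<^sup>2 = s * re_ip (f - q) x"
      using x0 by (simp add: s_def power2_eq_square)
    finally have "s * re_ip (f - q) x \<le> 0"
      by simp
    moreover have "s * re_ip (f - q) x = (re_ip (f - q) x)\<^sup>2 / (norm x)\<^sup>2"
      by (simp add: s_def power2_eq_square)
    moreover have "\<dots> > 0"
      using ne0 x0 by simp
    ultimately show False
      by simp
  qed
  have "ip (f - q) x = 0" if "x \<in> X" for x
    using perp[OF subspace_scale[OF sub that, of "ip (f - q) x"]]
    unfolding re_ip_scale_ip by simp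
  then show ?thesis
    using qX by blast
qed

lemma orth_proj_eqI:
  assumes X: "closed_subspace scale X" and p: "p \<in> X" "\<And>x. x \<in> X \<Longrightarrow> ip (f - p) x = 0"
  shows "orth_proj ip X f = p"
  unfolding orth_proj_def
proof (rule the_equality)
  show "p \<in> X \<and> (\<forall>x\<in>X. ip (f - p) x = 0)"
    using p by simp
  fix q assume q: "q \<in> X \<and> (\<forall>x\<in>X. ip (f - q) x = 0)"
  have sub: "subspace X"
    using X by (simp add: closed_subspace_def)
  have pq: "p - q \<in> X"
    using p(1) q subspace_diff[OF sub] by blast
  have "ip ((f - q) - (f - p)) (p - q) = 0"
    unfolding ip.diff_left[of "f - q"] using p(2)[OF pq] q pq by simp
  also have "(f - q) - (f - p) = p - q"
    by simp
  finally have "(of_real ((norm (p - q))\<^sup>2) :: 'k) = 0"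
    by (simp only: ip_self)
  then show "q = p"
    by simp
qed

lemma bounded_op_iff:
  "bounded_op scale F \<longleftrightarrow> (\<forall>x y. F (x + y) = F x + F y) \<and>
     (\<forall>c x. F (scale c x) = scale c (F x)) \<and> (\<exists>M. \<forall>x. norm (F x) \<le> M * norm x)"
  unfolding bounded_op_def Vector_Spaces.linear_iff using vector_space_axioms by blast

context
  fixes X
  assumes X: "closed_subspace scale X"
begin

lemma orth_proj_mem: "orth_proj ip X f \<in> X"
  and ip_diff_orth_proj: "x \<in> X \<Longrightarrow> ip (f - orth_proj ip X f) x = 0"
proof -
  obtain p where p: "p \<in> X" "\<And>x. x \<in> X \<Longrightarrow> ip (f - p) x = 0"
    using orth_proj_exists[OF X, of f] by blast
  have "orth_proj ip X f = p"
    using X p by (rule orth_proj_eqI)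
  then show "orth_proj ip X f \<in> X" "x \<in> X \<Longrightarrow> ip (f - orth_proj ip X f) x = 0"
    using p by auto
qed

lemma orth_proj_add: "orth_proj ip X (f + g) = orth_proj ip X f + orth_proj ip X g"
proof (rule orth_proj_eqI[OF X])
  show "orth_proj ip X f + orth_proj ip X g \<in> X"
    using X by (auto simp: closed_subspace_def intro: subspace_add orth_proj_mem)
  show "ip (f + g - (orth_proj ip X f + orth_proj ip X g)) x = 0" if "x \<in> X" for x
    using ip_diff_orth_proj[OF that, of f] ip_diff_orth_proj[OF that, of g]
    by (simp add: ip.diff_left ip.add_left)
qed

lemma orth_proj_scale: "orth_proj ip X (scale c f) = scale c (orth_proj ip X f)"
proof (rule orth_proj_eqI[OF X])
  show "scale c (orth_proj ip X f) \<in> X"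
    using X by (auto simp: closed_subspace_def intro: subspace_scale orth_proj_mem)
  show "ip (scale c f - scale c (orth_proj ip X f)) x = 0" if "x \<in> X" for x
    using ip_diff_orth_proj[OF that, of f]
    by (simp add: ip.diff_left ip_scale_left)
qed

lemma re_ip_orth_proj: "re_ip (orth_proj ip X f) g = re_ip (orth_proj ip X f) (orth_proj ip X g)"
  using re_ip_eq_0_if_ip_eq_0[OF ip_diff_orth_proj[OF orth_proj_mem, of g f]]
  unfolding re.diff_left by (simp add: re_ip_commute[of _ "orth_proj ip X f"])

lemma norm_orth_proj_sq: "(norm (orth_proj ip X f))\<^sup>2 = re_ip (orth_proj ip X f) f"
  by (simp add: re_ip_orth_proj re_ip_self)

lemma norm_orth_proj_le: "norm (orth_proj ip X f) \<le> norm f"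
proof (cases "orth_proj ip X f = 0")
  case False
  have "norm (orth_proj ip X f) * norm (orth_proj ip X f) \<le> norm (orth_proj ip X f) * norm f"
    using norm_orth_proj_sq[of f] re_ip_le[of "orth_proj ip X f" f] by (simp add: power2_eq_square)
  then show ?thesis
    using False by simp
qed simp

lemma bounded_op_orth_proj: "bounded_op scale (orth_proj ip X)"
  unfolding bounded_op_iff using norm_orth_proj_le
  by (auto simp: orth_proj_add orth_proj_scale intro!: exI[of _ 1])

end

lemma bounded_op_bounded_linear:
  assumes "bounded_op scale F"
  shows "bounded_linear F"
proof
  show "F (x + y) = F x + F y" for x y
    using assms by (simp add: bounded_op_iff)
  show "F (r *\<^sub>R x) = r *\<^sub>R F x" for r x
    using assms unfolding scale_of_real[symmetric] by (simp add: bounded_op_iff)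
  show "\<exists>K. \<forall>x. norm (F x) \<le> norm x * K"
    using assms by (simp add: bounded_op_iff mult.commute)
qed

lemma bounded_op_compose:
  assumes F: "bounded_op scale F" and G: "bounded_op scale G"
  shows "bounded_op scale (F \<circ> G)"
proof -
  have "bounded_linear (\<lambda>x. F (G x))"
    by (rule bounded_linear_compose[OF F[THEN bounded_op_bounded_linear]
          G[THEN bounded_op_bounded_linear]])
  then obtain M where "\<forall>x. norm (F (G x)) \<le> M * norm x"
    using bounded_linear.bounded by (metis mult.commute)
  then have "\<exists>M. \<forall>x. norm ((F \<circ> G) x) \<le> M * norm x"
    by auto
  moreover have "(F \<circ> G) (x + y) = (F \<circ> G) x + (F \<circ> G) y" for x y
    using F G by (simp add: bounded_op_iff)
  moreover have "(F \<circ> G) (scale c x) = scale c ((F \<circ> G) x)" for c x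
    using F G by (simp add: bounded_op_iff)
  ultimately show ?thesis
    unfolding bounded_op_iff by blast
qed

lemma bounded_op_scaleR:
  assumes F: "bounded_op scale F"
  shows "bounded_op scale (\<lambda>x. r *\<^sub>R F x)"
proof -
  obtain M where "\<And>x. norm (F x) \<le> M * norm x"
    using F by (auto simp: bounded_op_iff)
  then have "norm (r *\<^sub>R F x) \<le> (\<bar>r\<bar> * M) * norm x" for x
    by (simp add: mult.assoc mult_left_mono)
  moreover have "r *\<^sub>R scale c y = scale c (r *\<^sub>R y)" for c y
    by (simp only: scale_of_real[symmetric] scale_left_commute)
  ultimately show ?thesis
    using F unfolding bounded_op_iff by (auto simp: scaleR_add_right)
qed

lemma bounded_op_eqI:
  assumes F: "bounded_op scale F" and F': "bounded_op scale F'"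
    and eq: "\<And>x. x \<in> G \<Longrightarrow> F x = F' x" and dense: "closure (span G) = UNIV"
  shows "F = F'"
proof -
  interpret F: bounded_linear F
    by (rule bounded_op_bounded_linear[OF F])
  interpret F': bounded_linear F'
    by (rule bounded_op_bounded_linear[OF F'])
  have "subspace {x. F x = F' x}"
    using F F' by (intro subspaceI) (auto simp: bounded_op_iff F.zero F'.zero)
  then have "span G \<subseteq> {x. F x = F' x}"
    using eq by (intro span_minimal) auto
  moreover have "closed {x. F x = F' x}"
    using F F' by (intro closed_Collect_eq linear_continuous_on bounded_op_bounded_linear)
  ultimately have "UNIV \<subseteq> {x. F x = F' x}"
    using closure_minimal dense by blast
  then show ?thesis
    by auto
qed

end

section \<open>Fusion frame operators\<close>

definition fusion_frame_op ::
    "('h \<Rightarrow> 'h \<Rightarrow> 'k::rc_field) \<Rightarrow> 'i set \<Rightarrow> ('i \<Rightarrow> 'h::banach set) \<Rightarrow> ('i \<Rightarrow> real) \<Rightarrow> 'h \<Rightarrow> 'h" where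
  "fusion_frame_op ip I V v x = (\<Sum>\<^sub>\<infinity>i\<in>I. (v i)\<^sup>2 *\<^sub>R orth_proj ip (V i) x)"

context hilbert_space
begin

context
  fixes I :: "'i set" and V :: "'i \<Rightarrow> 'h set" and v :: "'i \<Rightarrow> real" and B :: real
  assumes closed_V: "\<And>i. i \<in> I \<Longrightarrow> closed_subspace scale (V i)"
    and B_pos: "0 < B"
    and bessel: "\<And>x F. finite F \<Longrightarrow> F \<subseteq> I \<Longrightarrow>
      (\<Sum>i\<in>F. (v i)\<^sup>2 * (norm (orth_proj ip (V i) x))\<^sup>2) \<le> B * (norm x)\<^sup>2"
begin

lemma bessel_norm_sum_le:
  assumes F: "finite F" "F \<subseteq> I"
  shows "(norm (\<Sum>i\<in>F. (v i)\<^sup>2 *\<^sub>R orth_proj ip (V i) x))\<^sup>2 \<le>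
    B * (\<Sum>i\<in>F. (v i)\<^sup>2 * (norm (orth_proj ip (V i) x))\<^sup>2)"
proof -
  define y where "y = (\<Sum>i\<in>F. (v i)\<^sup>2 *\<^sub>R orth_proj ip (V i) x)"
  have "2 * (norm y)\<^sup>2 = 2 * re_ip y y"
    by (simp add: re_ip_self)
  also have "re_ip y y = (\<Sum>i\<in>F. (v i)\<^sup>2 * re_ip (orth_proj ip (V i) x) y)"
    by (subst y_def) (simp add: re.sum_left re_ip_scaleR_left)
  also have "2 * \<dots> = (\<Sum>i\<in>F. (v i)\<^sup>2 * (2 * re_ip (orth_proj ip (V i) x) (orth_proj ip (V i) y)))"
    unfolding sum_distrib_left
  proof (rule sum.cong)
    fix i assume "i \<in> F"
    then show "2 * ((v i)\<^sup>2 * re_ip (orth_proj ip (V i) x) y) =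
        (v i)\<^sup>2 * (2 * re_ip (orth_proj ip (V i) x) (orth_proj ip (V i) y))"
      using re_ip_orth_proj[OF closed_V, of i x y] F by auto
  qed simp
  also have "\<dots> \<le> (\<Sum>i\<in>F. (v i)\<^sup>2 * (B * (norm (orth_proj ip (V i) x))\<^sup>2 +
      (norm (orth_proj ip (V i) y))\<^sup>2 / B))"
    by (intro sum_mono mult_left_mono re_ip_young B_pos) auto
  also have "\<dots> = B * (\<Sum>i\<in>F. (v i)\<^sup>2 * (norm (orth_proj ip (V i) x))\<^sup>2) +
      (\<Sum>i\<in>F. (v i)\<^sup>2 * (norm (orth_proj ip (V i) y))\<^sup>2) / B"
    by (simp add: sum_distrib_left sum_divide_distrib sum.distrib algebra_simps)
  also have "(\<Sum>i\<in>F. (v i)\<^sup>2 * (norm (orth_proj ip (V i) y))\<^sup>2) / B \<le> (norm y)\<^sup>2"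
    using bessel[OF F, of y] B_pos by (simp add: field_simps)
  finally show ?thesis
    by (simp add: y_def)
qed

lemma bessel_summable: "(\<lambda>i. (v i)\<^sup>2 * (norm (orth_proj ip (V i) x))\<^sup>2) summable_on I"
  by (rule nonneg_bdd_above_summable_on) (auto intro!: bdd_aboveI2[of _ _ "B * (norm x)\<^sup>2"] bessel)

lemma bessel_has_sum:
  "((\<lambda>i. (v i)\<^sup>2 *\<^sub>R orth_proj ip (V i) x) has_sum fusion_frame_op ip I V v x) I"
  unfolding fusion_frame_op_def
proof (rule has_sum_infsum, rule summable_on_if_norm_sum_le)
  show "(\<lambda>i. (v i)\<^sup>2 * (norm (orth_proj ip (V i) x))\<^sup>2) summable_on I"
    by (rule bessel_summable)
  show "0 \<le> B"
    using B_pos by simp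
qed (use bessel_norm_sum_le in auto)

lemma bessel_has_sum_norm:
  "((\<lambda>i. (v i)\<^sup>2 * (norm (orth_proj ip (V i) x))\<^sup>2) has_sum re_ip (fusion_frame_op ip I V v x) x) I"
proof -
  have "((\<lambda>i. re_ip ((v i)\<^sup>2 *\<^sub>R orth_proj ip (V i) x) x) has_sum
      re_ip (fusion_frame_op ip I V v x) x) I"
    by (rule has_sum_bounded_linear[OF re.bounded_linear_left bessel_has_sum])
  then show ?thesis
    by (rule has_sum_cong[THEN iffD1, rotated])
      (simp add: re_ip_scaleR_left norm_orth_proj_sq closed_V)
qed

lemma norm_bessel_op_le: "norm (fusion_frame_op ip I V v x) \<le> B * norm x"
proof (rule tendsto_upperbound)
  show "((\<lambda>F. norm (\<Sum>i\<in>F. (v i)\<^sup>2 *\<^sub>R orth_proj ip (V i) x)) \<longlongrightarrow>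
      norm (fusion_frame_op ip I V v x)) (finite_subsets_at_top I)"
    using bessel_has_sum[of x] unfolding has_sum_def by (rule tendsto_norm)
  show "\<forall>\<^sub>F F in finite_subsets_at_top I.
      norm (\<Sum>i\<in>F. (v i)\<^sup>2 *\<^sub>R orth_proj ip (V i) x) \<le> B * norm x"
  proof (rule eventually_finite_subsets_at_top_weakI)
    fix F assume F: "finite F" "F \<subseteq> I"
    have "(norm (\<Sum>i\<in>F. (v i)\<^sup>2 *\<^sub>R orth_proj ip (V i) x))\<^sup>2 \<le> B * (B * (norm x)\<^sup>2)"
      using bessel_norm_sum_le[OF F, of x] mult_left_mono[OF bessel[OF F, of x], of B] B_pos
      by linarith
    also have "\<dots> = (B * norm x)\<^sup>2"
      by (simp add: power2_eq_square)
    finally show "norm (\<Sum>i\<in>F. (v i)\<^sup>2 *\<^sub>R orth_proj ip (V i) x) \<le> B * norm x"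
      by (rule power2_le_imp_le) (use B_pos in simp)
  qed
qed (rule finite_subsets_at_top_neq_bot)

lemma bounded_op_bessel: "bounded_op scale (fusion_frame_op ip I V v)"
  unfolding bounded_op_iff
proof (intro conjI allI exI)
  show "norm (fusion_frame_op ip I V v x) \<le> B * norm x" for x
    by (rule norm_bessel_op_le)
  show "fusion_frame_op ip I V v (x + y) = fusion_frame_op ip I V v x + fusion_frame_op ip I V v y"
    for x y
  proof (rule has_sum_unique[OF bessel_has_sum])
    show "((\<lambda>i. (v i)\<^sup>2 *\<^sub>R orth_proj ip (V i) (x + y)) has_sum
        fusion_frame_op ip I V v x + fusion_frame_op ip I V v y) I"
      by (rule has_sum_cong[THEN iffD1, rotated, OF has_sum_add[OF bessel_has_sum bessel_has_sum]])
        (simp add: orth_proj_add closed_V scaleR_add_right)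
  qed
  show "fusion_frame_op ip I V v (scale c x) = scale c (fusion_frame_op ip I V v x)" for c x
  proof (rule has_sum_unique[OF bessel_has_sum])
    show "((\<lambda>i. (v i)\<^sup>2 *\<^sub>R orth_proj ip (V i) (scale c x)) has_sum
        scale c (fusion_frame_op ip I V v x)) I"
      by (rule has_sum_cong[THEN iffD1, rotated,
            OF has_sum_bounded_linear[OF bounded_linear_scale bessel_has_sum]])
        (simp add: orth_proj_scale closed_V scale_of_real[symmetric] scale_left_commute
          del: of_real_power)
  qed
qed

end

text \<open>
  Lax--Milgram: for \<open>\<rho> = \<alpha> / \<beta>\<^sup>2\<close> the map \<open>x \<mapsto> x - \<rho> (F x - y)\<close> is a contraction with constant
  \<open>sqrt (1 - \<alpha>\<^sup>2 / \<beta>\<^sup>2)\<close>.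
\<close>

lemma coercive_bij:
  assumes F: "bounded_op scale F" and \<alpha>: "0 < \<alpha>" "\<alpha> \<le> \<beta>"
    and upper: "\<And>x. norm (F x) \<le> \<beta> * norm x"
    and lower: "\<And>x. \<alpha> * (norm x)\<^sup>2 \<le> re_ip (F x) x"
  shows coercive_norm_ge: "\<alpha> * norm x \<le> norm (F x)"
    and "bij F" and bounded_op_inv: "bounded_op scale (inv F)"
proof -
  interpret F: bounded_linear F
    by (rule bounded_op_bounded_linear[OF F])
  have below: "\<alpha> * norm x \<le> norm (F x)" for x
  proof (cases "x = 0")
    case False
    have "\<alpha> * (norm x)\<^sup>2 \<le> norm (F x) * norm x"
      using lower[of x] re_ip_le[of "F x" x] by linarith
    then show ?thesis
      using False by (simp add: power2_eq_square)
  qed simp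
  then show "\<alpha> * norm x \<le> norm (F x)" .
  have "inj F"
  proof (rule injI)
    fix x y assume "F x = F y"
    then have "\<alpha> * norm (x - y) \<le> 0"
      using below[of "x - y"] by (simp add: F.diff)
    then show "x = y"
      using \<alpha> by (simp add: mult_le_0_iff)
  qed
  moreover have "\<exists>x. F x = y" for y
  proof -
    define \<rho> where "\<rho> = \<alpha> / \<beta>\<^sup>2"
    define c where "c = 1 - \<alpha>\<^sup>2 / \<beta>\<^sup>2"
    have \<rho>: "\<rho> > 0"
      using \<alpha> by (simp add: \<rho>_def)
    have c: "0 \<le> c" "c < 1"
      using \<alpha> by (auto simp: c_def power_mono)
    have contr: "norm (x - \<rho> *\<^sub>R F x) \<le> sqrt c * norm x" for x
    proof -
      have "(norm (x - \<rho> *\<^sub>R F x))\<^sup>2 = (norm x)\<^sup>2 - 2 * \<rho> * re_ip (F x) x + \<rho>\<^sup>2 * (norm (F x))\<^sup>2"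
        by (simp add: norm_diff_sq re_ip_scaleR_right power_mult_distrib re_ip_commute[of x])
      also have "\<dots> \<le> (norm x)\<^sup>2 - 2 * \<rho> * (\<alpha> * (norm x)\<^sup>2) + \<rho>\<^sup>2 * (\<beta> * norm x)\<^sup>2"
        using lower[of x] upper[of x] \<rho>
        by (intro add_mono diff_left_mono mult_left_mono power_mono) auto
      also have "\<dots> = c * (norm x)\<^sup>2"
        using \<alpha> by (simp add: \<rho>_def c_def field_simps power2_eq_square)
      also have "\<dots> = (sqrt c * norm x)\<^sup>2"
        using c by (simp add: power_mult_distrib)
      finally show ?thesis
        by (rule power2_le_imp_le) (use c in simp)
    qed
    have "\<exists>!x. x - \<rho> *\<^sub>R (F x - y) = x"
    proof (rule banach_fix_type[where c="sqrt c"])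
      have "(x - \<rho> *\<^sub>R (F x - y)) - (x' - \<rho> *\<^sub>R (F x' - y)) = (x - x') - \<rho> *\<^sub>R F (x - x')" for x x'
        by (simp add: F.diff algebra_simps)
      then show "\<forall>x x'. dist (x - \<rho> *\<^sub>R (F x - y)) (x' - \<rho> *\<^sub>R (F x' - y)) \<le> sqrt c * dist x x'"
        unfolding dist_norm by (simp only: contr simp_thms)
    qed (use c in auto)
    then obtain x where "x - \<rho> *\<^sub>R (F x - y) = x"
      by blast
    then show ?thesis
      using \<rho> by (intro exI[of _ x]) auto
  qed
  then have "surj F"
    by (metis surjI)
  ultimately show bij: "bij F"
    by (simp add: bij_def)
  have inv: "inv F z = x" if "F x = z" for x z
    using that \<open>inj F\<close> by auto
  have F_inv: "F (inv F z) = z" for z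
    using \<open>surj F\<close> by (rule surj_f_inv_f)
  show "bounded_op scale (inv F)"
    unfolding bounded_op_iff
  proof (intro conjI allI exI)
    show "norm (inv F x) \<le> (1 / \<alpha>) * norm x" for x
      using below[of "inv F x"] \<alpha> by (simp add: F_inv field_simps)
    show "inv F (x + y) = inv F x + inv F y" for x y
      by (rule inv) (simp add: F.add F_inv)
    show "inv F (scale c x) = scale c (inv F x)" for c x
      using F by (intro inv) (simp add: bounded_op_iff F_inv)
  qed
qed

context
  fixes I :: "'i set" and V :: "'i \<Rightarrow> 'h set" and v :: "'i \<Rightarrow> real" and A B :: real
  assumes ff: "fusion_frame scale ip I V v A B"
begin

lemma fusion_frame_closed: "i \<in> I \<Longrightarrow> closed_subspace scale (V i)"
  and fusion_frame_bounds_pos: "0 < A" "A \<le> B" "0 < B"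
  using ff by (auto simp: fusion_frame_def)

lemma fusion_frame_finite_sum_le:
  assumes "finite F" "F \<subseteq> I"
  shows "(\<Sum>i\<in>F. (v i)\<^sup>2 * (norm (orth_proj ip (V i) x))\<^sup>2) \<le> B * (norm x)\<^sup>2"
proof -
  have "(\<Sum>i\<in>F. (v i)\<^sup>2 * (norm (orth_proj ip (V i) x))\<^sup>2) \<le>
      (\<Sum>\<^sub>\<infinity>i\<in>I. (v i)\<^sup>2 * (norm (orth_proj ip (V i) x))\<^sup>2)"
    using ff assms by (intro finite_sum_le_infsum) (auto simp: fusion_frame_def)
  then show ?thesis
    using ff unfolding fusion_frame_def by (meson order_trans)
qed

lemmas fusion_frame_op_bessel =
  fusion_frame_closed fusion_frame_bounds_pos(3) fusion_frame_finite_sum_le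

lemma fusion_frame_has_sum:
  "((\<lambda>i. (v i)\<^sup>2 *\<^sub>R orth_proj ip (V i) x) has_sum fusion_frame_op ip I V v x) I"
  by (rule bessel_has_sum[OF fusion_frame_op_bessel])

lemma bounded_op_fusion_frame_op: "bounded_op scale (fusion_frame_op ip I V v)"
  by (rule bounded_op_bessel[OF fusion_frame_op_bessel])

lemma norm_fusion_frame_op_le: "norm (fusion_frame_op ip I V v x) \<le> B * norm x"
  by (rule norm_bessel_op_le[OF fusion_frame_op_bessel])

lemma fusion_frame_op_coercive: "A * (norm x)\<^sup>2 \<le> re_ip (fusion_frame_op ip I V v x) x"
proof -
  have "(\<Sum>\<^sub>\<infinity>i\<in>I. (v i)\<^sup>2 * (norm (orth_proj ip (V i) x))\<^sup>2) =
      re_ip (fusion_frame_op ip I V v x) x"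
    by (rule infsumI[OF bessel_has_sum_norm[OF fusion_frame_op_bessel]])
  moreover have "A * (norm x)\<^sup>2 \<le> (\<Sum>\<^sub>\<infinity>i\<in>I. (v i)\<^sup>2 * (norm (orth_proj ip (V i) x))\<^sup>2)"
    using ff by (simp add: fusion_frame_def)
  ultimately show ?thesis
    by simp
qed

lemma norm_fusion_frame_op_ge: "A * norm x \<le> norm (fusion_frame_op ip I V v x)"
  and bij_fusion_frame_op: "bij (fusion_frame_op ip I V v)"
  and bounded_op_inv_fusion_frame_op: "bounded_op scale (inv (fusion_frame_op ip I V v))"
  using coercive_bij[OF bounded_op_fusion_frame_op fusion_frame_bounds_pos(1,2)
      norm_fusion_frame_op_le fusion_frame_op_coercive] by auto

end

lemma fusion_frame_denseI:
  fixes I :: "'i set" and V :: "'i \<Rightarrow> 'h set" and v :: "'i \<Rightarrow> real"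
  assumes V: "\<And>i. i \<in> I \<Longrightarrow> closed_subspace scale (V i)" and v: "\<And>i. i \<in> I \<Longrightarrow> 0 < v i"
    and AB: "0 < A" "A \<le> B" and dense: "closure E = UNIV"
    and E: "\<And>x. x \<in> E \<Longrightarrow> \<exists>s. ((\<lambda>i. (v i)\<^sup>2 * (norm (orth_proj ip (V i) x))\<^sup>2) has_sum s) I \<and>
      A * (norm x)\<^sup>2 \<le> s \<and> s \<le> B * (norm x)\<^sup>2"
  shows "fusion_frame scale ip I V v A B"
proof -
  have cont: "continuous_on UNIV (orth_proj ip (V i))" if "i \<in> I" for i
    by (intro linear_continuous_on bounded_op_bounded_linear bounded_op_orth_proj V that)
  have bessel: "(\<Sum>i\<in>F. (v i)\<^sup>2 * (norm (orth_proj ip (V i) x))\<^sup>2) \<le> B * (norm x)\<^sup>2"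
    if F: "finite F" "F \<subseteq> I" for x F
  proof -
    let ?Z = "{x. (\<Sum>i\<in>F. (v i)\<^sup>2 * (norm (orth_proj ip (V i) x))\<^sup>2) \<le> B * (norm x)\<^sup>2}"
    have "x \<in> ?Z" if "x \<in> E" for x
    proof -
      obtain s where "((\<lambda>i. (v i)\<^sup>2 * (norm (orth_proj ip (V i) x))\<^sup>2) has_sum s) I"
        "s \<le> B * (norm x)\<^sup>2"
        using E[OF \<open>x \<in> E\<close>] by blast
      moreover from this(1) F
      have "(\<Sum>i\<in>F. (v i)\<^sup>2 * (norm (orth_proj ip (V i) x))\<^sup>2) \<le> s"
        by (rule finite_sum_le_has_sum) auto
      ultimately show ?thesis
        by simp
    qed
    moreover have "closed ?Z"
      using F cont by (intro closed_Collect_le continuous_intros) auto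
    ultimately have "closure E \<subseteq> ?Z"
      by (intro closure_minimal) auto
    then show ?thesis
      using dense by auto
  qed
  have B: "0 < B"
    using AB by simp
  note bessel_facts = V B bessel
  let ?S = "fusion_frame_op ip I V v"
  have lower: "A * (norm x)\<^sup>2 \<le> re_ip (?S x) x" for x
  proof -
    let ?Z = "{x. A * (norm x)\<^sup>2 \<le> re_ip (?S x) x}"
    have "x \<in> ?Z" if "x \<in> E" for x
      using E[OF that] has_sum_unique[OF bessel_has_sum_norm[OF bessel_facts, of I x]] by blast
    moreover have "closed ?Z"
      by (intro closed_Collect_le continuous_intros re.continuous_on linear_continuous_on
          bounded_op_bounded_linear bounded_op_bessel[OF bessel_facts])
    ultimately have "closure E \<subseteq> ?Z"
      by (intro closure_minimal) auto
    then show ?thesis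
      using dense by auto
  qed
  have "(\<Sum>\<^sub>\<infinity>i\<in>I. (v i)\<^sup>2 * (norm (orth_proj ip (V i) x))\<^sup>2) = re_ip (?S x) x" for x
    by (rule infsumI[OF bessel_has_sum_norm[OF bessel_facts]])
  moreover have "(\<Sum>\<^sub>\<infinity>i\<in>I. (v i)\<^sup>2 * (norm (orth_proj ip (V i) x))\<^sup>2) \<le> B * (norm x)\<^sup>2" for x
    by (rule infsum_le_finite_sums[OF bessel_summable[OF bessel_facts] bessel])
  ultimately show ?thesis
    unfolding fusion_frame_def
    using V v AB lower bessel_summable[OF bessel_facts] by simp
qed

end

section \<open>Tensor products of fusion frames\<close>

context hilbert_tensor
begin

lemma norm_tensor: "norm (t f g) = norm f * norm g"
proof -
  have "(of_real ((norm (t f g))\<^sup>2) :: 'k) = of_real ((norm f * norm g)\<^sup>2)"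
    by (simp only: L.ip_self[symmetric] ip_tensor H.ip_self K.ip_self of_real_mult[symmetric]
        power_mult_distrib)
  then have "(norm (t f g))\<^sup>2 = (norm f * norm g)\<^sup>2"
    by (simp only: of_real_eq_iff)
  then show ?thesis
    by simp
qed

sublocale t: bounded_bilinear t
proof
  show "t (r *\<^sub>R f) g = r *\<^sub>R t f g" for r f g
    by (simp only: H.scale_of_real[symmetric] L.scale_of_real[symmetric] tensor_scale_left)
  show "t f (r *\<^sub>R g) = r *\<^sub>R t f g" for r f g
    by (simp only: K.scale_of_real[symmetric] L.scale_of_real[symmetric] tensor_scale_right)
  show "\<exists>M. \<forall>f g. norm (t f g) \<le> norm f * norm g * M"
    by (rule exI[of _ 1]) (simp add: norm_tensor)
qed (rule tensor_add_left tensor_add_right)+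

lemma hilbert_tensor_swap: "hilbert_tensor sK ipK sH ipH sL ipL (\<lambda>g f. t f g)"
proof -
  have "{t f g |g f. True} = {t f g |f g. True}"
    by auto
  then show ?thesis
    using dense_tensors
    by unfold_locales (auto simp: tensor_add_left tensor_add_right tensor_scale_left
        tensor_scale_right ip_tensor mult.commute)
qed

lemma tensor_subspace_swap: "tensor_subspace sL (\<lambda>g f. t f g) Y X = tensor_subspace sL t X Y"
proof -
  have "{t f g |g f. g \<in> Y \<and> f \<in> X} = {t f g |f g. f \<in> X \<and> g \<in> Y}"
    by auto
  then show ?thesis
    by (simp add: tensor_subspace_def)
qed

lemma closed_tensor_subspace: "closed_subspace sL (tensor_subspace sL t X Y)"
  unfolding tensor_subspace_def by (intro L.closed_subspace_closure L.subspace_span)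

lemma bounded_op_tensor_eqI:
  assumes "bounded_op sL F" "bounded_op sL F'" and "\<And>f g. F (t f g) = F' (t f g)"
  shows "F = F'"
  by (rule L.bounded_op_eqI[OF assms(1,2) _ dense_tensors]) (use assms(3) in auto)

lemma orth_proj_tensor:
  assumes X: "closed_subspace sH X" and Y: "closed_subspace sK Y"
  shows "orth_proj ipL (tensor_subspace sL t X Y) (t f g) = t (orth_proj ipH X f) (orth_proj ipK Y g)"
proof (rule L.orth_proj_eqI[OF closed_tensor_subspace])
  have "t (orth_proj ipH X f) (orth_proj ipK Y g) \<in> {t f g |f g. f \<in> X \<and> g \<in> Y}"
    using H.orth_proj_mem[OF X] K.orth_proj_mem[OF Y] by blast
  then show "t (orth_proj ipH X f) (orth_proj ipK Y g) \<in> tensor_subspace sL t X Y"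
    unfolding tensor_subspace_def by (intro subsetD[OF closure_subset] L.span_base)
  fix z assume "z \<in> tensor_subspace sL t X Y"
  then show "ipL (t f g - t (orth_proj ipH X f) (orth_proj ipK Y g)) z = 0"
    unfolding tensor_subspace_def
  proof (rule L.ip_eq_0_closure_span[rotated])
    fix z assume "z \<in> {t f g |f g. f \<in> X \<and> g \<in> Y}"
    then obtain x y where xy: "x \<in> X" "y \<in> Y" "z = t x y"
      by auto
    have "ipH f x = ipH (orth_proj ipH X f) x" "ipK g y = ipK (orth_proj ipK Y g) y"
      using H.ip_diff_orth_proj[OF X xy(1), of f] K.ip_diff_orth_proj[OF Y xy(2), of g]
      by (simp_all add: H.ip.diff_left K.ip.diff_left)
    then show "ipL (t f g - t (orth_proj ipH X f) (orth_proj ipK Y g)) z = 0"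
      by (simp add: xy(3) L.ip.diff_left ip_tensor)
  qed
qed

lemma closed_subspace_UNIV: "closed_subspace sH UNIV" "closed_subspace sK UNIV"
  by (auto simp: closed_subspace_def)

lemma orth_proj_UNIV: "orth_proj ipH UNIV f = f" "orth_proj ipK UNIV g = g"
  by (rule H.orth_proj_eqI[OF closed_subspace_UNIV(1)] K.orth_proj_eqI[OF closed_subspace_UNIV(2)];
      simp add: H.ip.zero_left K.ip.zero_left)+

lemma orth_proj_tensor_compose:
  assumes X: "closed_subspace sH X" and Y: "closed_subspace sK Y"
  shows "orth_proj ipL (tensor_subspace sL t X Y) =
    orth_proj ipL (tensor_subspace sL t UNIV Y) \<circ> orth_proj ipL (tensor_subspace sL t X UNIV)"
proof (rule bounded_op_tensor_eqI)
  show "orth_proj ipL (tensor_subspace sL t X Y) (t f g) =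
      (orth_proj ipL (tensor_subspace sL t UNIV Y) \<circ> orth_proj ipL (tensor_subspace sL t X UNIV))
        (t f g)" for f g
    by (simp add: orth_proj_tensor X Y closed_subspace_UNIV orth_proj_UNIV)
qed (rule L.bounded_op_compose L.bounded_op_orth_proj closed_tensor_subspace)+

text \<open>
  Gram--Schmidt without normalization: the vectors \<open>e m\<close> may vanish, and the coefficient \<open>a m\<close> is
  then \<open>0 / 0 = 0\<close>.
\<close>

lemma span_tensor_orthogonal:
  assumes "z \<in> L.span {t f g |f g. True}"
  shows "\<exists>(n::nat) h e. z = (\<Sum>m<n. t (h m) (e m)) \<and>
    (\<forall>m<n. \<forall>m'<n. m \<noteq> m' \<longrightarrow> ipK (e m) (e m') = 0)"
  using assms
proof (induction rule: L.span_induct_alt)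
  case base
  show ?case
    by (intro exI[of _ 0]) simp
next
  case (step c x z)
  obtain f g where x: "x = t f g"
    using step(1) by blast
  obtain n :: nat and h e where z: "z = (\<Sum>m<n. t (h m) (e m))"
    and orth: "\<And>m m'. m < n \<Longrightarrow> m' < n \<Longrightarrow> m \<noteq> m' \<Longrightarrow> ipK (e m) (e m') = 0"
    using step(2) by blast
  define a where "a m = ipK g (e m) / ipK (e m) (e m)" for m
  define g' where "g' = g - (\<Sum>m<n. sK (a m) (e m))"
  define f' where "f' = sH c f"
  define h' where "h' = (\<lambda>m. if m < n then h m + sH (a m) f' else f')"
  define e' where "e' = (\<lambda>m. if m < n then e m else g')"
  have perp: "ipK g' (e k) = 0" if "k < n" for k
  proof -
    have "(\<Sum>m<n. a m * ipK (e m) (e k)) = (\<Sum>m<n. if m = k then a k * ipK (e k) (e k) else 0)"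
      using orth that by (intro sum.cong) auto
    also have "\<dots> = a k * ipK (e k) (e k)"
      using that by simp
    also have "\<dots> = ipK g (e k)"
      by (cases "e k = 0") (auto simp: a_def K.ip_self K.ip.zero_right)
    finally show ?thesis
      by (simp add: g'_def K.ip.diff_left K.ip.sum_left K.ip_scale_left)
  qed
  have "sL c x = t f' ((\<Sum>m<n. sK (a m) (e m)) + g')"
    by (simp add: x f'_def g'_def tensor_scale_left)
  also have "\<dots> = (\<Sum>m<n. t (sH (a m) f') (e m)) + t f' g'"
    by (simp add: tensor_add_right t.sum_right tensor_scale_left tensor_scale_right)
  finally have "sL c x + z = (\<Sum>m<n. t (h m + sH (a m) f') (e m)) + t f' g'"
    by (simp add: z tensor_add_left sum.distrib)
  also have "\<dots> = (\<Sum>m<Suc n. t (h' m) (e' m))"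
    by (simp add: h'_def e'_def)
  finally have "sL c x + z = (\<Sum>m<Suc n. t (h' m) (e' m))" .
  moreover have "ipK (e' m) (e' m') = 0" if "m < Suc n" "m' < Suc n" "m \<noteq> m'" for m m'
    using that orth perp K.ip_commute[of "e m" "g'"]
    by (cases "m < n"; cases "m' < n") (auto simp: e'_def)
  ultimately show ?case
    by blast
qed

lemma norm_sum_tensor_orthogonal:
  assumes "\<And>m m'. m < n \<Longrightarrow> m' < n \<Longrightarrow> m \<noteq> m' \<Longrightarrow> ipK (e m) (e m') = 0"
  shows "(norm (\<Sum>m<n. t (h m) (e m)))\<^sup>2 = (\<Sum>m<(n::nat). (norm (e m))\<^sup>2 * (norm (h m))\<^sup>2)"
  using assms
proof (induction n)
  case (Suc n)
  have "ipL (\<Sum>m<n. t (h m) (e m)) (t (h n) (e n)) = 0"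
    using Suc.prems by (simp add: L.ip.sum_left ip_tensor)
  then have "re_ip (\<Sum>m<n. t (h m) (e m)) (t (h n) (e n)) = 0"
    by (rule L.re_ip_eq_0_if_ip_eq_0)
  then show ?case
    using Suc by (simp add: L.norm_add_sq norm_tensor power_mult_distrib mult.commute)
qed simp

lemma fusion_frame_tensor_left:
  assumes V: "fusion_frame sH ipH I V v A B"
  shows "fusion_frame sL ipL I (\<lambda>i. tensor_subspace sL t (V i) UNIV) v A B"
proof (rule L.fusion_frame_denseI[OF closed_tensor_subspace _ _ _ dense_tensors])
  show "0 < v i" if "i \<in> I" for i
    using V that by (simp add: fusion_frame_def)
  show "0 < A" "A \<le> B"
    using V by (auto simp: fusion_frame_def)
  fix z assume "z \<in> L.span {t f g |f g. True}"
  then obtain n :: nat and h e where z: "z = (\<Sum>m<n. t (h m) (e m))"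
    and orth: "\<And>m m'. m < n \<Longrightarrow> m' < n \<Longrightarrow> m \<noteq> m' \<Longrightarrow> ipK (e m) (e m') = 0"
    using span_tensor_orthogonal by blast
  let ?q = "\<lambda>f i. (v i)\<^sup>2 * (norm (orth_proj ipH (V i) f))\<^sup>2"
  have P: "(v i)\<^sup>2 * (norm (orth_proj ipL (tensor_subspace sL t (V i) UNIV) z))\<^sup>2 =
      (\<Sum>m<n. (norm (e m))\<^sup>2 * ?q (h m) i)" if i: "i \<in> I" for i
  proof -
    interpret P: bounded_linear "orth_proj ipL (tensor_subspace sL t (V i) UNIV)"
      by (intro L.bounded_op_bounded_linear L.bounded_op_orth_proj closed_tensor_subspace)
    have "orth_proj ipL (tensor_subspace sL t (V i) UNIV) z =
        (\<Sum>m<n. t (orth_proj ipH (V i) (h m)) (e m))"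
      by (simp add: z P.sum orth_proj_tensor H.fusion_frame_closed[OF V i] closed_subspace_UNIV
          orth_proj_UNIV)
    then show ?thesis
      by (simp add: norm_sum_tensor_orthogonal orth sum_distrib_left mult_ac)
  qed
  have q: "(?q f has_sum infsum (?q f) I) I" "A * (norm f)\<^sup>2 \<le> infsum (?q f) I"
    "infsum (?q f) I \<le> B * (norm f)\<^sup>2" for f
    using V by (auto simp: fusion_frame_def)
  have "((\<lambda>i. \<Sum>m<n. (norm (e m))\<^sup>2 * ?q (h m) i) has_sum
      (\<Sum>m<n. (norm (e m))\<^sup>2 * infsum (?q (h m)) I)) I"
  proof (induction n)
    case (Suc n)
    show ?case
      using has_sum_add[OF Suc has_sum_cmult_right[OF q(1), of "(norm (e n))\<^sup>2" "h n"]] by simp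
  qed simp
  then have "((\<lambda>i. (v i)\<^sup>2 * (norm (orth_proj ipL (tensor_subspace sL t (V i) UNIV) z))\<^sup>2) has_sum
      (\<Sum>m<n. (norm (e m))\<^sup>2 * infsum (?q (h m)) I)) I"
    by (rule has_sum_cong[THEN iffD1, rotated]) (simp only: P)
  moreover have "(norm z)\<^sup>2 = (\<Sum>m<n. (norm (e m))\<^sup>2 * (norm (h m))\<^sup>2)"
    unfolding z by (rule norm_sum_tensor_orthogonal[OF orth])
  then have "A * (norm z)\<^sup>2 = (\<Sum>m<n. (norm (e m))\<^sup>2 * (A * (norm (h m))\<^sup>2))"
    and "B * (norm z)\<^sup>2 = (\<Sum>m<n. (norm (e m))\<^sup>2 * (B * (norm (h m))\<^sup>2))"
    by (simp_all add: sum_distrib_left mult_ac)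
  ultimately show "\<exists>s. ((\<lambda>i. (v i)\<^sup>2 * (norm (orth_proj ipL (tensor_subspace sL t (V i) UNIV) z))\<^sup>2)
      has_sum s) I \<and> A * (norm z)\<^sup>2 \<le> s \<and> s \<le> B * (norm z)\<^sup>2"
    by (intro exI[of _ "\<Sum>m<n. (norm (e m))\<^sup>2 * infsum (?q (h m)) I"])
      (auto intro!: sum_mono mult_left_mono q)
qed

lemma fusion_frame_tensor_right:
  assumes W: "fusion_frame sK ipK J W w C D"
  shows "fusion_frame sL ipL J (\<lambda>j. tensor_subspace sL t UNIV (W j)) w C D"
  using hilbert_tensor.fusion_frame_tensor_left[OF hilbert_tensor_swap W]
  by (simp only: tensor_subspace_swap)

lemma fusion_frame_tensor:
  assumes V: "fusion_frame sH ipH I V v A B" and W: "fusion_frame sK ipK J W w C D"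
  shows "fusion_frame sL ipL (I \<times> J) (\<lambda>(i, j). tensor_subspace sL t (V i) (W j))
    (\<lambda>(i, j). v i * w j) (A * C) (B * D)"
proof -
  note V' = fusion_frame_tensor_left[OF V] and W' = fusion_frame_tensor_right[OF W]
  let ?P = "\<lambda>i. orth_proj ipL (tensor_subspace sL t (V i) UNIV)"
  let ?Q = "\<lambda>j. orth_proj ipL (tensor_subspace sL t UNIV (W j))"
  let ?R = "\<lambda>i j. orth_proj ipL (tensor_subspace sL t (V i) (W j))"
  have R: "?R i j z = ?Q j (?P i z)" if "i \<in> I" "j \<in> J" for i j z
    using orth_proj_tensor_compose[OF H.fusion_frame_closed[OF V that(1)]
        K.fusion_frame_closed[OF W that(2)]] by simp
  note pos = H.fusion_frame_bounds_pos[OF V] K.fusion_frame_bounds_pos[OF W]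
  define q where "q z i j = (v i * w j)\<^sup>2 * (norm (?R i j z))\<^sup>2" for z i j
  have q_eq: "q z i j = (v i)\<^sup>2 * ((w j)\<^sup>2 * (norm (?Q j (?P i z)))\<^sup>2)"
    if "i \<in> I" "j \<in> J" for z i j
    using that by (simp add: q_def R power_mult_distrib)
  have summ: "(\<lambda>(i, j). q z i j) summable_on I \<times> J" for z
  proof (rule nonneg_bdd_above_summable_on)
    show "bdd_above (sum (\<lambda>(i, j). q z i j) ` {F. F \<subseteq> I \<times> J \<and> finite F})"
    proof (rule bdd_aboveI2)
      fix F assume "F \<in> {F. F \<subseteq> I \<times> J \<and> finite F}"
      then have F: "finite F" "F \<subseteq> I \<times> J"
        by auto
      have F1: "finite (fst ` F)" "fst ` F \<subseteq> I" and F2: "finite (snd ` F)" "snd ` F \<subseteq> J"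
        using F by auto
      have "(\<Sum>(i, j)\<in>F. q z i j) \<le> (\<Sum>(i, j)\<in>fst ` F \<times> snd ` F. q z i j)"
        using F1 F2 by (intro sum_mono2) (force simp: q_def)+
      also have "\<dots> = (\<Sum>i\<in>fst ` F. \<Sum>j\<in>snd ` F. q z i j)"
        by (simp add: sum.cartesian_product)
      also have "\<dots> = (\<Sum>i\<in>fst ` F. (v i)\<^sup>2 * (\<Sum>j\<in>snd ` F. (w j)\<^sup>2 * (norm (?Q j (?P i z)))\<^sup>2))"
        unfolding sum_distrib_left using F1 F2 by (intro sum.cong refl q_eq) auto
      also have "\<dots> \<le> (\<Sum>i\<in>fst ` F. (v i)\<^sup>2 * (D * (norm (?P i z))\<^sup>2))"
        by (intro sum_mono mult_left_mono L.fusion_frame_finite_sum_le[OF W' F2]) auto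
      also have "\<dots> = D * (\<Sum>i\<in>fst ` F. (v i)\<^sup>2 * (norm (?P i z))\<^sup>2)"
        by (simp add: sum_distrib_left mult_ac)
      also have "\<dots> \<le> D * (B * (norm z)\<^sup>2)"
        using pos by (intro mult_left_mono L.fusion_frame_finite_sum_le[OF V' F1]) auto
      finally show "(\<Sum>(i, j)\<in>F. q z i j) \<le> D * (B * (norm z)\<^sup>2)" .
    qed
  qed (auto simp: q_def)
  have Vs: "(\<lambda>i. (v i)\<^sup>2 * (norm (?P i z))\<^sup>2) summable_on I"
    "A * (norm z)\<^sup>2 \<le> (\<Sum>\<^sub>\<infinity>i\<in>I. (v i)\<^sup>2 * (norm (?P i z))\<^sup>2)"
    "(\<Sum>\<^sub>\<infinity>i\<in>I. (v i)\<^sup>2 * (norm (?P i z))\<^sup>2) \<le> B * (norm z)\<^sup>2" for z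
    using V' by (auto simp: fusion_frame_def)
  have Ws: "C * (norm z)\<^sup>2 \<le> (\<Sum>\<^sub>\<infinity>j\<in>J. (w j)\<^sup>2 * (norm (?Q j z))\<^sup>2)"
    "(\<Sum>\<^sub>\<infinity>j\<in>J. (w j)\<^sup>2 * (norm (?Q j z))\<^sup>2) \<le> D * (norm z)\<^sup>2" for z
    using W' by (auto simp: fusion_frame_def)
  have inner: "infsum (q z i) J = (v i)\<^sup>2 * (\<Sum>\<^sub>\<infinity>j\<in>J. (w j)\<^sup>2 * (norm (?Q j (?P i z)))\<^sup>2)"
    if "i \<in> I" for z i
    using that by (simp add: infsum_cmult_right'[symmetric] q_eq cong: infsum_cong)
  have lower: "A * C * (norm z)\<^sup>2 \<le> (\<Sum>\<^sub>\<infinity>(i, j)\<in>I \<times> J. q z i j)"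
    and upper: "(\<Sum>\<^sub>\<infinity>(i, j)\<in>I \<times> J. q z i j) \<le> B * D * (norm z)\<^sup>2" for z
  proof -
    have "A * C * (norm z)\<^sup>2 = C * (A * (norm z)\<^sup>2)"
      by simp
    also have "\<dots> \<le> C * (\<Sum>\<^sub>\<infinity>i\<in>I. (v i)\<^sup>2 * (norm (?P i z))\<^sup>2)"
      using pos by (intro mult_left_mono Vs) auto
    also have "\<dots> = (\<Sum>\<^sub>\<infinity>i\<in>I. C * ((v i)\<^sup>2 * (norm (?P i z))\<^sup>2))"
      by (simp add: infsum_cmult_right')
    also have "\<dots> \<le> (\<Sum>\<^sub>\<infinity>i\<in>I. infsum (q z i) J)"
    proof (rule infsum_mono)
      fix i assume i: "i \<in> I"
      show "C * ((v i)\<^sup>2 * (norm (?P i z))\<^sup>2) \<le> infsum (q z i) J"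
        using mult_left_mono[OF Ws(1)[of "?P i z"], of "(v i)\<^sup>2"] by (simp add: inner[OF i] mult_ac)
    qed (intro summable_on_cmult_right Vs summable_on_Sigma_banach summ)+
    also have "\<dots> = (\<Sum>\<^sub>\<infinity>(i, j)\<in>I \<times> J. q z i j)"
      by (rule infsum_Sigma'_banach[OF summ])
    finally show "A * C * (norm z)\<^sup>2 \<le> (\<Sum>\<^sub>\<infinity>(i, j)\<in>I \<times> J. q z i j)" .
    have "(\<Sum>\<^sub>\<infinity>(i, j)\<in>I \<times> J. q z i j) = (\<Sum>\<^sub>\<infinity>i\<in>I. infsum (q z i) J)"
      by (rule infsum_Sigma'_banach[OF summ, symmetric])
    also have "\<dots> \<le> (\<Sum>\<^sub>\<infinity>i\<in>I. D * ((v i)\<^sup>2 * (norm (?P i z))\<^sup>2))"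
    proof (rule infsum_mono)
      fix i assume i: "i \<in> I"
      show "infsum (q z i) J \<le> D * ((v i)\<^sup>2 * (norm (?P i z))\<^sup>2)"
        using mult_left_mono[OF Ws(2)[of "?P i z"], of "(v i)\<^sup>2"] by (simp add: inner[OF i] mult_ac)
    qed (intro summable_on_cmult_right Vs summable_on_Sigma_banach summ)+
    also have "\<dots> = D * (\<Sum>\<^sub>\<infinity>i\<in>I. (v i)\<^sup>2 * (norm (?P i z))\<^sup>2)"
      by (simp add: infsum_cmult_right')
    also have "\<dots> \<le> D * (B * (norm z)\<^sup>2)"
      using pos by (intro mult_left_mono Vs) auto
    finally show "(\<Sum>\<^sub>\<infinity>(i, j)\<in>I \<times> J. q z i j) \<le> B * D * (norm z)\<^sup>2"
      by (simp add: mult_ac)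
  qed
  have q': "(\<lambda>p. (case p of (i, j) \<Rightarrow> v i * w j)\<^sup>2 *
      (norm (orth_proj ipL (case p of (i, j) \<Rightarrow> tensor_subspace sL t (V i) (W j)) z))\<^sup>2) =
      (\<lambda>(i, j). q z i j)" for z
    by (auto simp: q_def fun_eq_iff)
  have "0 < v i" "0 < w j" if "i \<in> I" "j \<in> J" for i j
    using V W that by (auto simp: fusion_frame_def)
  moreover have "A * C \<le> B * D" "0 < A * C"
    using pos by (auto intro: mult_mono)
  ultimately show ?thesis
    unfolding fusion_frame_def q' using closed_tensor_subspace summ lower upper by auto
qed

context
  fixes I :: "'i set" and V :: "'i \<Rightarrow> 'h set" and v :: "'i \<Rightarrow> real" and A B :: real
    and J :: "'j set" and W :: "'j \<Rightarrow> 'g set" and w :: "'j \<Rightarrow> real" and C D :: real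
  assumes V: "fusion_frame sH ipH I V v A B" and W: "fusion_frame sK ipK J W w C D"
begin

abbreviation "S\<^sub>L \<equiv> fusion_frame_op ipL (I \<times> J)
  (\<lambda>(i, j). tensor_subspace sL t (V i) (W j)) (\<lambda>(i, j). v i * w j)"

lemma tensor_fusion_frame_has_sum:
  "((\<lambda>(i, j). ((v i)\<^sup>2 * (w j)\<^sup>2) *\<^sub>R orth_proj ipL (tensor_subspace sL t (V i) (W j)) z)
    has_sum S\<^sub>L z) (I \<times> J)"
proof -
  have "(\<lambda>p. (case p of (i, j) \<Rightarrow> v i * w j)\<^sup>2 *\<^sub>R
        orth_proj ipL (case p of (i, j) \<Rightarrow> tensor_subspace sL t (V i) (W j)) z) =
      (\<lambda>(i, j). ((v i)\<^sup>2 * (w j)\<^sup>2) *\<^sub>R orth_proj ipL (tensor_subspace sL t (V i) (W j)) z)"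
    by (auto simp: fun_eq_iff power_mult_distrib)
  then show ?thesis
    using L.fusion_frame_has_sum[OF fusion_frame_tensor[OF V W], of z] by simp
qed

lemma tensor_frame_operator_eq: "tensor_frame_operator sL ipL t I V v J W w = S\<^sub>L"
  unfolding tensor_frame_operator_def
proof (rule the_equality)
  note ff = fusion_frame_tensor[OF V W]
  show "bounded_op sL S\<^sub>L \<and> bij S\<^sub>L \<and> bounded_op sL (inv S\<^sub>L) \<and>
      (\<forall>f g. ((\<lambda>(i, j). ((v i)\<^sup>2 * (w j)\<^sup>2) *\<^sub>R
          orth_proj ipL (tensor_subspace sL t (V i) (W j)) (t f g)) has_sum S\<^sub>L (t f g)) (I \<times> J))"
    using L.bounded_op_fusion_frame_op[OF ff] L.bij_fusion_frame_op[OF ff]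
      L.bounded_op_inv_fusion_frame_op[OF ff] tensor_fusion_frame_has_sum by blast
  fix S assume S: "bounded_op sL S \<and> bij S \<and> bounded_op sL (inv S) \<and>
      (\<forall>f g. ((\<lambda>(i, j). ((v i)\<^sup>2 * (w j)\<^sup>2) *\<^sub>R
          orth_proj ipL (tensor_subspace sL t (V i) (W j)) (t f g)) has_sum S (t f g)) (I \<times> J))"
  show "S = S\<^sub>L"
  proof (rule bounded_op_tensor_eqI)
    show "S (t f g) = S\<^sub>L (t f g)" for f g
      using S tensor_fusion_frame_has_sum has_sum_unique by blast
  qed (use S L.bounded_op_fusion_frame_op[OF ff] in auto)
qed

lemma fusion_frame_op_tensor:
  "S\<^sub>L (t f g) = t (fusion_frame_op ipH I V v f) (fusion_frame_op ipK J W w g)"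
proof (rule has_sum_unique)
  let ?p = "\<lambda>i. (v i)\<^sup>2 *\<^sub>R orth_proj ipH (V i) f" and ?q = "\<lambda>j. (w j)\<^sup>2 *\<^sub>R orth_proj ipK (W j) g"
  show "((\<lambda>i. t (?p i) (fusion_frame_op ipK J W w g)) has_sum
      t (fusion_frame_op ipH I V v f) (fusion_frame_op ipK J W w g)) I"
    by (rule has_sum_bounded_linear[OF t.bounded_linear_left H.fusion_frame_has_sum[OF V]])
  show "((\<lambda>i. t (?p i) (fusion_frame_op ipK J W w g)) has_sum S\<^sub>L (t f g)) I"
  proof (rule has_sum_SigmaD[OF tensor_fusion_frame_has_sum])
    fix i assume i: "i \<in> I"
    have "((\<lambda>j. t (?p i) (?q j)) has_sum t (?p i) (fusion_frame_op ipK J W w g)) J"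
      by (rule has_sum_bounded_linear[OF t.bounded_linear_right K.fusion_frame_has_sum[OF W]])
    then show "((\<lambda>j. case (i, j) of (i, j) \<Rightarrow> ((v i)\<^sup>2 * (w j)\<^sup>2) *\<^sub>R
        orth_proj ipL (tensor_subspace sL t (V i) (W j)) (t f g)) has_sum
        t (?p i) (fusion_frame_op ipK J W w g)) J"
      by (rule has_sum_cong[THEN iffD1, rotated])
        (simp add: orth_proj_tensor H.fusion_frame_closed[OF V i] K.fusion_frame_closed[OF W]
          t.scaleR_left t.scaleR_right mult.commute)
  qed
qed

lemma inv_fusion_frame_op_tensor:
  "inv S\<^sub>L (t f g) = t (inv (fusion_frame_op ipH I V v) f) (inv (fusion_frame_op ipK J W w) g)"
proof (rule inv_f_eq)
  show "inj S\<^sub>L"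
    using L.bij_fusion_frame_op[OF fusion_frame_tensor[OF V W]] by (rule bij_is_inj)
  show "S\<^sub>L (t (inv (fusion_frame_op ipH I V v) f) (inv (fusion_frame_op ipK J W w) g)) = t f g"
    unfolding fusion_frame_op_tensor
    using H.bij_fusion_frame_op[OF V] K.bij_fusion_frame_op[OF W]
    by (simp add: surj_f_inv_f bij_is_surj)
qed

end

lemma tensor_op_eqI:
  assumes R: "bounded_op sL R" and eq: "\<And>f g. R (t f g) = t (Q f) (T g)"
  shows "tensor_op sL t Q T = R"
  unfolding tensor_op_def using assms by (intro the_equality bounded_op_tensor_eqI) auto

end

theorem theorem3p12:
  fixes sH :: "'k::rc_field \<Rightarrow> 'h::banach \<Rightarrow> 'h" and ipH :: "'h \<Rightarrow> 'h \<Rightarrow> 'k"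
    and sK :: "'k \<Rightarrow> 'g::banach \<Rightarrow> 'g" and ipK :: "'g \<Rightarrow> 'g \<Rightarrow> 'k"
    and sL :: "'k \<Rightarrow> 'l::banach \<Rightarrow> 'l" and ipL :: "'l \<Rightarrow> 'l \<Rightarrow> 'k"
    and t :: "'h \<Rightarrow> 'g \<Rightarrow> 'l"
    and I :: "'i set" and V :: "'i \<Rightarrow> 'h set" and v :: "'i \<Rightarrow> real"
    and J :: "'j set" and W :: "'j \<Rightarrow> 'g set" and w :: "'j \<Rightarrow> real"
    and A B C D :: real
    and S :: "'l \<Rightarrow> 'l"
  assumes tensor: "hilbert_tensor sH ipH sK ipK sL ipL t"
    and sepH: "separable_space (euclidean :: 'h topology)"
    and sepK: "separable_space (euclidean :: 'g topology)"
    and V: "fusion_frame sH ipH I V v A B"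
    and W: "fusion_frame sK ipK J W w C D"
    and S: "S = tensor_frame_operator sL ipL t I V v J W w"
  shows
    "(\<exists>T U. (\<forall>i\<in>I. bounded_op sH (T i)) \<and> (\<forall>j\<in>J. bounded_op sK (U j)) \<and>
        (\<forall>i\<in>I. \<forall>j\<in>J. tensor_op sL t (T i) (U j) =
           orth_proj ipL (tensor_subspace sL t (V i) (W j)) \<circ> inv S)) \<and>
     (\<forall>T U. (\<forall>i\<in>I. bounded_op sH (T i)) \<and> (\<forall>j\<in>J. bounded_op sK (U j)) \<and>
        (\<forall>i\<in>I. \<forall>j\<in>J. tensor_op sL t (T i) (U j) =
           orth_proj ipL (tensor_subspace sL t (V i) (W j)) \<circ> inv S) \<longrightarrow>
        tensor_resolution_of_identity sL t (I \<times> J)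
          (\<lambda>(i, j) z. ((v i)\<^sup>2 * (w j)\<^sup>2) *\<^sub>R tensor_op sL t (T i) (U j) z) \<and>
        (\<forall>a b :: real. a * b = 1 \<longrightarrow> (\<forall>f g.
          (\<lambda>(i, j). (v i)\<^sup>2 * (w j)\<^sup>2 * (norm (tensor_op sL t (T i) (U j) (t f g)))\<^sup>2)
            summable_on (I \<times> J) \<and>
          A * C / (B\<^sup>2 * D\<^sup>2) * a\<^sup>2 * b\<^sup>2 * (norm (t f g))\<^sup>2 \<le>
            (\<Sum>\<^sub>\<infinity>(i, j)\<in>I \<times> J. (v i)\<^sup>2 * (w j)\<^sup>2 * (norm (tensor_op sL t (T i) (U j) (t f g)))\<^sup>2) \<and>
          (\<Sum>\<^sub>\<infinity>(i, j)\<in>I \<times> J. (v i)\<^sup>2 * (w j)\<^sup>2 * (norm (tensor_op sL t (T i) (U j) (t f g)))\<^sup>2) \<le>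
            B * D / (A\<^sup>2 * C\<^sup>2) * a\<^sup>2 * b\<^sup>2 * (norm (t f g))\<^sup>2)))"
proof -
  interpret hilbert_tensor sH ipH sK ipK sL ipL t
    by (rule tensor)
  note ff = fusion_frame_tensor[OF V W]
  let ?P = "\<lambda>i j. orth_proj ipL (tensor_subspace sL t (V i) (W j))"
  have S_eq: "S = fusion_frame_op ipL (I \<times> J)
      (\<lambda>(i, j). tensor_subspace sL t (V i) (W j)) (\<lambda>(i, j). v i * w j)"
    unfolding S by (rule tensor_frame_operator_eq[OF V W])
  have S_bij: "bij S" and S_inv: "bounded_op sL (inv S)"
    and S_le: "\<And>z. norm (S z) \<le> B * D * norm z" and S_ge: "\<And>z. A * C * norm z \<le> norm (S z)"
    unfolding S_eq
    by (rule L.bij_fusion_frame_op[OF ff] L.bounded_op_inv_fusion_frame_op[OF ff]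
        L.norm_fusion_frame_op_le[OF ff] L.norm_fusion_frame_op_ge[OF ff])+
  have S_inv_eq: "S (inv S z) = z" for z
    using S_bij by (simp add: bij_is_surj surj_f_inv_f)
  have bounded_P_inv: "bounded_op sL (?P i j \<circ> inv S)" for i j
    by (intro L.bounded_op_compose L.bounded_op_orth_proj closed_tensor_subspace S_inv)
  show ?thesis
  proof (intro conjI allI impI)
    let ?T = "\<lambda>i. orth_proj ipH (V i) \<circ> inv (fusion_frame_op ipH I V v)"
    let ?U = "\<lambda>j. orth_proj ipK (W j) \<circ> inv (fusion_frame_op ipK J W w)"
    have "tensor_op sL t (?T i) (?U j) = ?P i j \<circ> inv S" if "i \<in> I" "j \<in> J" for i j
      by (rule tensor_op_eqI[OF bounded_P_inv])
        (simp add: S_eq inv_fusion_frame_op_tensor[OF V W] orth_proj_tensor that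
          H.fusion_frame_closed[OF V] K.fusion_frame_closed[OF W])
    moreover have "bounded_op sH (?T i)" if "i \<in> I" for i
      by (intro H.bounded_op_compose H.bounded_op_orth_proj H.fusion_frame_closed[OF V that]
          H.bounded_op_inv_fusion_frame_op[OF V])
    moreover have "bounded_op sK (?U j)" if "j \<in> J" for j
      by (intro K.bounded_op_compose K.bounded_op_orth_proj K.fusion_frame_closed[OF W that]
          K.bounded_op_inv_fusion_frame_op[OF W])
    ultimately show "\<exists>T U. (\<forall>i\<in>I. bounded_op sH (T i)) \<and> (\<forall>j\<in>J. bounded_op sK (U j)) \<and>
        (\<forall>i\<in>I. \<forall>j\<in>J. tensor_op sL t (T i) (U j) = ?P i j \<circ> inv S)"
      by (intro exI[of _ ?T] exI[of _ ?U]) blast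
  next
    fix T U
    assume TU: "(\<forall>i\<in>I. bounded_op sH (T i)) \<and> (\<forall>j\<in>J. bounded_op sK (U j)) \<and>
        (\<forall>i\<in>I. \<forall>j\<in>J. tensor_op sL t (T i) (U j) = ?P i j \<circ> inv S)"
    then have TU_eq: "tensor_op sL t (T i) (U j) = ?P i j \<circ> inv S" if "i \<in> I" "j \<in> J" for i j
      using that by blast
    show "tensor_resolution_of_identity sL t (I \<times> J)
        (\<lambda>(i, j) z. ((v i)\<^sup>2 * (w j)\<^sup>2) *\<^sub>R tensor_op sL t (T i) (U j) z)"
      unfolding tensor_resolution_of_identity_def
    proof (intro conjI ballI allI)
      fix n assume "n \<in> I \<times> J"
      then obtain i j where n: "n = (i, j)" "i \<in> I" "j \<in> J"
        by blast
      show "bounded_op sL (case n of (i, j) \<Rightarrow>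
          \<lambda>z. ((v i)\<^sup>2 * (w j)\<^sup>2) *\<^sub>R tensor_op sL t (T i) (U j) z)"
        unfolding n(1) prod.case TU_eq[OF n(2,3)]
        by (rule L.bounded_op_scaleR[OF bounded_P_inv])
    next
      fix f g
      have "((\<lambda>(i, j). ((v i)\<^sup>2 * (w j)\<^sup>2) *\<^sub>R ?P i j (inv S (t f g))) has_sum t f g) (I \<times> J)"
        using tensor_fusion_frame_has_sum[OF V W, of "inv S (t f g)", folded S_eq]
        by (simp only: S_inv_eq)
      then show "((\<lambda>n. (case n of (i, j) \<Rightarrow>
          \<lambda>z. ((v i)\<^sup>2 * (w j)\<^sup>2) *\<^sub>R tensor_op sL t (T i) (U j) z) (t f g)) has_sum t f g) (I \<times> J)"
        by (rule has_sum_cong[THEN iffD1, rotated]) (auto simp: TU_eq)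
    qed
    fix a b :: real and f g
    assume "a * b = 1"
    then have ab: "x * a\<^sup>2 * b\<^sup>2 = x" for x
      by (simp add: mult.assoc power_mult_distrib[symmetric])
    define z where "z = inv S (t f g)"
    have pos: "0 < A" "0 < B" "0 < C" "0 < D"
      using H.fusion_frame_bounds_pos[OF V] K.fusion_frame_bounds_pos[OF W] by auto
    let ?q = "\<lambda>(i, j). (v i)\<^sup>2 * (w j)\<^sup>2 * (norm (?P i j z))\<^sup>2"
    have q_eq: "(\<lambda>p. (case p of (i, j) \<Rightarrow> v i * w j)\<^sup>2 *
        (norm (orth_proj ipL (case p of (i, j) \<Rightarrow> tensor_subspace sL t (V i) (W j)) z))\<^sup>2) = ?q"
      by (auto simp: fun_eq_iff power_mult_distrib)
    have q: "?q summable_on I \<times> J" "A * C * (norm z)\<^sup>2 \<le> infsum ?q (I \<times> J)"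
      "infsum ?q (I \<times> J) \<le> B * D * (norm z)\<^sup>2"
      using ff unfolding fusion_frame_def by (simp_all only: q_eq[symmetric])
    let ?r = "\<lambda>(i, j). (v i)\<^sup>2 * (w j)\<^sup>2 * (norm (tensor_op sL t (T i) (U j) (t f g)))\<^sup>2"
    have r: "?r p = ?q p" if "p \<in> I \<times> J" for p
      using that by (auto simp: TU_eq z_def)
    show "?r summable_on I \<times> J"
      using q(1) by (simp only: r cong: summable_on_cong)
    have infsum_r: "infsum ?r (I \<times> J) = infsum ?q (I \<times> J)"
      by (rule infsum_cong[OF r])
    have "(norm (t f g))\<^sup>2 \<le> (B * D * norm z)\<^sup>2"
      using S_le[of z] by (intro power_mono) (auto simp: z_def S_inv_eq)
    then have "A * C / (B\<^sup>2 * D\<^sup>2) * (norm (t f g))\<^sup>2 \<le> A * C / (B\<^sup>2 * D\<^sup>2) * (B * D * norm z)\<^sup>2"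
      using pos by (intro mult_left_mono) auto
    also have "\<dots> = A * C * (norm z)\<^sup>2"
      using pos by (simp add: power_mult_distrib)
    finally show "A * C / (B\<^sup>2 * D\<^sup>2) * a\<^sup>2 * b\<^sup>2 * (norm (t f g))\<^sup>2 \<le> infsum ?r (I \<times> J)"
      unfolding ab infsum_r using q(2) by linarith
    have "(A * C * norm z)\<^sup>2 \<le> (norm (t f g))\<^sup>2"
      using S_ge[of z] pos by (intro power_mono) (auto simp: z_def S_inv_eq)
    then have "B * D / (A\<^sup>2 * C\<^sup>2) * (A * C * norm z)\<^sup>2 \<le> B * D / (A\<^sup>2 * C\<^sup>2) * (norm (t f g))\<^sup>2"
      using pos by (intro mult_left_mono) auto
    moreover have "B * D / (A\<^sup>2 * C\<^sup>2) * (A * C * norm z)\<^sup>2 = B * D * (norm z)\<^sup>2"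
      using pos by (simp add: power_mult_distrib)
    ultimately show "infsum ?r (I \<times> J) \<le> B * D / (A\<^sup>2 * C\<^sup>2) * a\<^sup>2 * b\<^sup>2 * (norm (t f g))\<^sup>2"
      unfolding ab infsum_r using q(3) by linarith
  qed
qed

end
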